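(* Let $k \geq 2$ be an integer. The finite satisfiability problem and the infinite satisfiability problem for $\mathsf{BSR}(\mathsf{SL}^k)$ are both undecidable. That is, there is no algorithm that decides, given a $\mathsf{BSR}(\mathsf{SL}^k)$ sentence, whether it has a model with a finite universe. Likewise, there is no algorithm that decides, given such a sentence, whether it has a model with an infinite universe.
   Context: Fix an integer $k\ge 1$ and a countable set $\mathsf{Var}$ of variables. Formulae of Separation Logic $\mathsf{SL}^k$ are generated by $\varphi ::= \bot \mid \top \mid \mathsf{emp} \mid x\approx y \mid x\mapsto(y_1,\dots,y_k) \mid \varphi\wedge\varphi \mid \neg\varphi \mid \varphi * \varphi \mid \varphi \mathrel{-\!\!*} \varphi \mid \exists x.\varphi$, where $x,y,y_1,\dots,y_k\in\mathsf{Var}$. They are interpreted over structures $(\mathfrak U,\mathfrak s,\mathfrak h)$. Here $\mathfrak U$ is a nonempty countable set (the universe, finite or infinite), $\mathfrak s$ maps variables to $\mathfrak U$ (the store), and $\mathfrak h:\mathfrak U\rightharpoonup\mathfrak U^k$ is a finite partial function (the heap). The semantics is as follows. - $\mathsf{emp}$ holds iff $\mathfrak h=\emptyset$. - $x\mapsto(y_1,\dots,y_k)$ holds iff $\mathfrak h=\{(\mathfrak s(x),(\mathfrak s(y_1),\dots,\mathfrak s(y_k)))\}$. - $\varphi_1*\varphi_2$ holds iff $\mathfrak h=\mathfrak h_1\uplus\mathfrak h_2$ for some heaps $\mathfrak h_1,\mathfrak h_2$ with disjoint domains such that $(\mathfrak U,\mathfrak s,\mathfrak h_i)\models\varphi_i$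 for $i=1,2$. - $\varphi_1\mathrel{-\!\!*}\varphi_2$ holds iff for every heap $\mathfrak h'$ whose domain is disjoint from that of $\mathfrak h$ and with $(\mathfrak U,\mathfrak s,\mathfrak h')\models\varphi_1$, we have $(\mathfrak U,\mathfrak s,\mathfrak h\uplus\mathfrak h')\models\varphi_2$. - Equality, the boolean connectives and $\exists$ have the usual meaning, with $\exists$ ranging over $\mathfrak U$. $\mathsf{BSR}(\mathsf{SL}^k)$ is the set of sentences $\exists x_1\dots\exists x_n\forall y_1\dots\forall y_m.\phi$ with $\phi$ a quantifier-free $\mathsf{SL}^k$ formula. The finite (respectively infinite) satisfiability problem asks whether a given sentence has a model $(\mathfrak U,\mathfrak s,\mathfrak h)$ with $\mathfrak U$ finite (respectively infinite). *)

theory Defs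
  imports "HOL-Library.Nat_Bijection" "HOL-Library.Countable_Set"
begin

type_synonym var = nat

datatype sl =
    Bot
  | Top
  | Emp
  | Eq var var
  | PointsTo var "var list"
  | Conj sl sl
  | Neg sl
  | Star sl sl
  | Wand sl sl
  | Exists var sl

abbreviation Forall :: "var \<Rightarrow> sl \<Rightarrow> sl" where
  "Forall y \<phi> \<equiv> Neg (Exists y (Neg \<phi>))"

text \<open>The formulae of \<open>SL\<^sup>k\<close> are the terms of type \<^typ>\<open>sl\<close> satisfying \<open>wf_sl k\<close>.\<close>

primrec wf_sl :: "nat \<Rightarrow> sl \<Rightarrow> bool" where
  "wf_sl k Bot = True"
| "wf_sl k Top = True"
| "wf_sl k Emp = True"
| "wf_sl k (Eq x y) = True"
| "wf_sl k (PointsTo x ys) = (length ys = k)"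
| "wf_sl k (Conj \<phi> \<psi>) = (wf_sl k \<phi> \<and> wf_sl k \<psi>)"
| "wf_sl k (Neg \<phi>) = wf_sl k \<phi>"
| "wf_sl k (Star \<phi> \<psi>) = (wf_sl k \<phi> \<and> wf_sl k \<psi>)"
| "wf_sl k (Wand \<phi> \<psi>) = (wf_sl k \<phi> \<and> wf_sl k \<psi>)"
| "wf_sl k (Exists x \<phi>) = wf_sl k \<phi>"

primrec fv :: "sl \<Rightarrow> var set" where
  "fv Bot = {}"
| "fv Top = {}"
| "fv Emp = {}"
| "fv (Eq x y) = {x, y}"
| "fv (PointsTo x ys) = insert x (set ys)"
| "fv (Conj \<phi> \<psi>) = fv \<phi> \<union> fv \<psi>"
| "fv (Neg \<phi>) = fv \<phi>"
| "fv (Star \<phi> \<psi>) = fv \<phi> \<union> fv \<psi>"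
| "fv (Wand \<phi> \<psi>) = fv \<phi> \<union> fv \<psi>"
| "fv (Exists x \<phi>) = fv \<phi> - {x}"

primrec quantifier_free :: "sl \<Rightarrow> bool" where
  "quantifier_free Bot = True"
| "quantifier_free Top = True"
| "quantifier_free Emp = True"
| "quantifier_free (Eq x y) = True"
| "quantifier_free (PointsTo x ys) = True"
| "quantifier_free (Conj \<phi> \<psi>) = (quantifier_free \<phi> \<and> quantifier_free \<psi>)"
| "quantifier_free (Neg \<phi>) = quantifier_free \<phi>"
| "quantifier_free (Star \<phi> \<psi>) = (quantifier_free \<phi> \<and> quantifier_free \<psi>)"
| "quantifier_free (Wand \<phi> \<psi>) = (quantifier_free \<phi> \<and> quantifier_free \<psi>)"
| "quantifier_free (Exists x \<phi>) = False"

definition BSR :: "nat \<Rightarrow> sl set" where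
  "BSR k = {\<phi>. fv \<phi> = {} \<and>
     (\<exists>xs ys \<psi>. \<phi> = foldr Exists xs (foldr Forall ys \<psi>) \<and> quantifier_free \<psi> \<and> wf_sl k \<psi>)}"

type_synonym 'u heap = "'u \<Rightarrow> 'u list option"

definition is_heap :: "nat \<Rightarrow> 'u set \<Rightarrow> 'u heap \<Rightarrow> bool" where
  "is_heap k U h \<longleftrightarrow> finite (dom h) \<and> dom h \<subseteq> U \<and>
     (\<forall>us \<in> ran h. length us = k \<and> set us \<subseteq> U)"

text \<open>The parameter \<open>k\<close> is needed because the separating implication quantifies over
  all heaps of width \<open>k\<close>.\<close>

primrec models :: "nat \<Rightarrow> 'u set \<Rightarrow> (var \<Rightarrow> 'u) \<Rightarrow> 'u heap \<Rightarrow> sl \<Rightarrow> bool" where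
  "models k U s h Bot = False"
| "models k U s h Top = True"
| "models k U s h Emp = (h = Map.empty)"
| "models k U s h (Eq x y) = (s x = s y)"
| "models k U s h (PointsTo x ys) = (h = [s x \<mapsto> map s ys])"
| "models k U s h (Conj \<phi> \<psi>) = (models k U s h \<phi> \<and> models k U s h \<psi>)"
| "models k U s h (Neg \<phi>) = (\<not> models k U s h \<phi>)"
| "models k U s h (Star \<phi> \<psi>) =
     (\<exists>h1 h2. is_heap k U h1 \<and> is_heap k U h2 \<and> dom h1 \<inter> dom h2 = {} \<and> h = h1 ++ h2 \<and>
        models k U s h1 \<phi> \<and> models k U s h2 \<psi>)"
| "models k U s h (Wand \<phi> \<psi>) =
     (\<forall>h'. is_heap k U h' \<and> dom h \<inter> dom h' = {} \<and> models k U s h' \<phi> \<longrightarrow>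
        models k U s (h ++ h') \<psi>)"
| "models k U s h (Exists x \<phi>) = (\<exists>u\<in>U. models k U (s(x := u)) h \<phi>)"

definition is_structure :: "nat \<Rightarrow> 'u set \<Rightarrow> (var \<Rightarrow> 'u) \<Rightarrow> 'u heap \<Rightarrow> bool" where
  "is_structure k U s h \<longleftrightarrow>
     U \<noteq> {} \<and> countable U \<and> (\<forall>x. s x \<in> U) \<and> is_heap k U h"

text \<open>Universes range over sets of natural numbers; up to isomorphism these are all
  countable sets, see \<open>models_nat_universe\<close> below.\<close>

definition finitely_satisfiable :: "nat \<Rightarrow> sl \<Rightarrow> bool" where
  "finitely_satisfiable k \<phi> \<longleftrightarrow>
     (\<exists>(U :: nat set) s h. is_structure k U s h \<and> finite U \<and> models k U s h \<phi>)"

definition infinitely_satisfiable :: "nat \<Rightarrow> sl \<Rightarrow> bool" where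
  "infinitely_satisfiable k \<phi> \<longleftrightarrow>
     (\<exists>(U :: nat set) s h. is_structure k U s h \<and> infinite U \<and> models k U s h \<phi>)"

definition heap_image :: "'u set \<Rightarrow> ('u \<Rightarrow> 'v) \<Rightarrow> 'u heap \<Rightarrow> 'v heap" where
  "heap_image U f h =
     (\<lambda>v. if v \<in> f ` U then map_option (map f) (h (inv_into U f v)) else None)"

lemma heap_image_apply:
  assumes "inj_on f U" "u \<in> U"
  shows "heap_image U f h (f u) = map_option (map f) (h u)"
  using assms by (simp add: heap_image_def)

lemma dom_heap_image:
  assumes "inj_on f U" "dom h \<subseteq> U"
  shows "dom (heap_image U f h) = f ` dom h"
proof (intro equalityI subsetI)
  fix v assume "v \<in> dom (heap_image U f h)"
  then obtain us where us: "heap_image U f h v = Some us" by blast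
  then obtain u where u: "u \<in> U" "v = f u"
    by (auto simp: heap_image_def split: if_splits)
  with us assms show "v \<in> f ` dom h"
    by (auto simp: heap_image_apply)
next
  fix v assume "v \<in> f ` dom h"
  then obtain u where u: "u \<in> dom h" "v = f u" by blast
  then have "u \<in> U" using assms by blast
  with u assms show "v \<in> dom (heap_image U f h)"
    by (auto simp: heap_image_apply)
qed

lemma is_heap_heap_image:
  assumes inj: "inj_on f U" and h: "is_heap k U h"
  shows "is_heap k (f ` U) (heap_image U f h)"
proof -
  have d: "dom h \<subseteq> U" and fin: "finite (dom h)" using h by (auto simp: is_heap_def)
  have "length vs = k \<and> set vs \<subseteq> f ` U" if vs: "vs \<in> ran (heap_image U f h)" for vs
  proof -
    obtain v where v: "heap_image U f h v = Some vs" using vs unfolding ran_def by blast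
    then obtain u where u: "u \<in> U" "v = f u"
      by (auto simp: heap_image_def split: if_splits)
    then obtain us where us: "h u = Some us" "vs = map f us"
      using v inj by (auto simp: heap_image_apply)
    then have "us \<in> ran h" by (auto simp: ran_def)
    then show ?thesis using h us by (auto simp: is_heap_def)
  qed
  then show ?thesis
    using d fin inj by (auto simp: is_heap_def dom_heap_image)
qed

lemma heap_image_inverse:
  assumes inj: "inj_on f U" and h: "is_heap k U h"
  shows "heap_image (f ` U) (inv_into U f) (heap_image U f h) = h"
proof
  fix u
  have inj': "inj_on (inv_into U f) (f ` U)" by (simp add: inj_on_inv_into)
  have im: "inv_into U f ` f ` U = U" using inj by simp
  show "heap_image (f ` U) (inv_into U f) (heap_image U f h) u = h u"
  proof (cases "u \<in> U")
    case True
    have "heap_image (f ` U) (inv_into U f) (heap_image U f h) (inv_into U f (f u))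
        = map_option (map (inv_into U f)) (heap_image U f h (f u))"
      by (rule heap_image_apply[OF inj']) (use True in auto)
    also have "\<dots> = map_option (map (inv_into U f)) (map_option (map f) (h u))"
      using True inj by (simp add: heap_image_apply)
    also have "\<dots> = h u"
    proof (cases "h u")
      case (Some us)
      then have "set us \<subseteq> U" using h by (auto simp: is_heap_def ran_def)
      then have "map (inv_into U f \<circ> f) us = us"
        using inj by (intro map_idI) auto
      then show ?thesis using Some by simp
    qed simp
    finally show ?thesis using True inj by simp
  next
    case False
    then have "h u = None" using h by (auto simp: is_heap_def)
    then show ?thesis using False im by (simp add: heap_image_def[of "f ` U"])
  qed
qed

lemma heap_image_surj:
  assumes inj: "inj_on f U" and g: "is_heap k (f ` U) g"
  obtains h where "is_heap k U h" "g = heap_image U f h"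
proof -
  let ?i = "inv_into U f"
  have inj': "inj_on ?i (f ` U)" by (simp add: inj_on_inv_into)
  have im: "?i ` f ` U = U" using inj by simp
  have 1: "is_heap k U (heap_image (f ` U) ?i g)"
    using is_heap_heap_image[OF inj' g] im by simp
  have eq: "inv_into (f ` U) ?i u = f u" if "u \<in> U" for u
    by (metis im imageI inj inj' inv_into_f_f that)
  have "heap_image U f (heap_image (f ` U) ?i g) =
      heap_image (?i ` f ` U) (inv_into (f ` U) ?i) (heap_image (f ` U) ?i g)"
  proof
    fix v
    show "heap_image U f (heap_image (f ` U) ?i g) v =
      heap_image (?i ` f ` U) (inv_into (f ` U) ?i) (heap_image (f ` U) ?i g) v"
    proof (cases "v \<in> f ` U")
      case True
      then obtain u where u: "u \<in> U" "v = f u" by blast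
      have l: "heap_image U f (heap_image (f ` U) ?i g) v
          = map_option (map f) (heap_image (f ` U) ?i g u)"
        using u inj by (simp add: heap_image_apply)
      have "heap_image U (inv_into (f ` U) ?i) (heap_image (f ` U) ?i g) (inv_into (f ` U) ?i u)
          = map_option (map (inv_into (f ` U) ?i)) (heap_image (f ` U) ?i g u)"
        by (rule heap_image_apply) (use u im in \<open>auto simp: inj_on_def eq inj_onD[OF inj]\<close>)
      moreover have "map_option (map (inv_into (f ` U) ?i)) (heap_image (f ` U) ?i g u)
          = map_option (map f) (heap_image (f ` U) ?i g u)"
      proof (cases "heap_image (f ` U) ?i g u")
        case (Some us)
        then have "set us \<subseteq> U" using 1 by (auto simp: is_heap_def ran_def)
        then show ?thesis using Some eq by auto
      qed simp
      ultimately show ?thesis using l u im eq by simp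
    next
      case False
      have "inv_into (f ` U) ?i ` U = f ` U" using eq by (intro image_cong) auto
      then show ?thesis using False im by (simp add: heap_image_def[of U])
    qed
  qed
  also have "\<dots> = g" by (rule heap_image_inverse[OF inj' g])
  finally show ?thesis using that[OF 1] by simp
qed

lemma heap_image_add: "heap_image U f (h1 ++ h2) = heap_image U f h1 ++ heap_image U f h2"
  by (rule ext) (auto simp: heap_image_def map_add_def split: option.splits)

lemma heap_image_inj:
  assumes "inj_on f U" "is_heap k U h1" "is_heap k U h2"
  shows "heap_image U f h1 = heap_image U f h2 \<longleftrightarrow> h1 = h2"
  using heap_image_inverse assms by metis

lemma is_heap_add: "is_heap k U h1 \<Longrightarrow> is_heap k U h2 \<Longrightarrow> is_heap k U (h1 ++ h2)"
  by (auto simp: is_heap_def ran_def map_add_Some_iff)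

lemma dom_heap_image_disjoint:
  assumes "inj_on f U" "is_heap k U h1" "is_heap k U h2"
  shows "dom (heap_image U f h1) \<inter> dom (heap_image U f h2) = {} \<longleftrightarrow> dom h1 \<inter> dom h2 = {}"
proof -
  have "dom h1 \<subseteq> U" "dom h2 \<subseteq> U" using assms by (auto simp: is_heap_def)
  then show ?thesis
    using assms(1) by (simp add: dom_heap_image inj_on_image_Int[symmetric])
qed

lemma models_heap_image:
  assumes inj: "inj_on f U"
  shows "is_heap k U h \<Longrightarrow> (\<forall>x. s x \<in> U) \<Longrightarrow>
    models k (f ` U) (f \<circ> s) (heap_image U f h) \<phi> \<longleftrightarrow> models k U s h \<phi>"
proof (induction \<phi> arbitrary: s h)
  case Emp
  have "heap_image U f Map.empty = Map.empty" by (auto simp: heap_image_def)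
  moreover have "is_heap k U Map.empty" by (simp add: is_heap_def)
  ultimately show ?case using heap_image_inj[OF inj Emp(1)] by fastforce
next
  case (Eq x y)
  then show ?case using inj by (auto simp: inj_on_def)
next
  case (PointsTo x ys)
  let ?g = "[s x \<mapsto> map s ys]" and ?g' = "[f (s x) \<mapsto> map (f \<circ> s) ys]"
  have e: "heap_image U f ?g = ?g'"
  proof
    fix v show "heap_image U f ?g v = ?g' v"
    proof (cases "v \<in> f ` U")
      case True
      then obtain u where u: "u \<in> U" "v = f u" by blast
      then have "f u = f (s x) \<longleftrightarrow> u = s x" using inj PointsTo.prems(2) by (simp add: inj_on_eq_iff)
      then show ?thesis using u heap_image_apply[OF inj u(1), of ?g] by simp
    next
      case False
      then show ?thesis using PointsTo.prems(2) by (auto simp: heap_image_def)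
    qed
  qed
  have "heap_image U f h = ?g' \<longleftrightarrow> h = ?g"
  proof (cases "length ys = k")
    case True
    then have "is_heap k U ?g" using PointsTo.prems(2) by (auto simp: is_heap_def)
    then show ?thesis using heap_image_inj[OF inj PointsTo.prems(1)] e by metis
  next
    case False
    then have "h \<noteq> ?g" using PointsTo.prems(1) by (auto simp: is_heap_def)
    moreover have "heap_image U f h \<noteq> ?g'"
      using False is_heap_heap_image[OF inj PointsTo.prems(1)] by (auto simp: is_heap_def)
    ultimately show ?thesis by simp
  qed
  then show ?case by (simp add: comp_def)
next
  case (Star \<phi> \<psi>)
  show ?case
  proof
    assume "models k (f ` U) (f \<circ> s) (heap_image U f h) (Star \<phi> \<psi>)"
    then obtain g1 g2 where g: "is_heap k (f ` U) g1" "is_heap k (f ` U) g2"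
      "dom g1 \<inter> dom g2 = {}" "heap_image U f h = g1 ++ g2"
      "models k (f ` U) (f \<circ> s) g1 \<phi>" "models k (f ` U) (f \<circ> s) g2 \<psi>" by auto
    obtain h1 where h1: "is_heap k U h1" "g1 = heap_image U f h1"
      using heap_image_surj[OF inj g(1)] .
    obtain h2 where h2: "is_heap k U h2" "g2 = heap_image U f h2"
      using heap_image_surj[OF inj g(2)] .
    have "h = h1 ++ h2"
      using g(4) h1 h2 heap_image_inj[OF inj Star.prems(1) is_heap_add[OF h1(1) h2(1)]]
      by (simp add: heap_image_add)
    moreover have "dom h1 \<inter> dom h2 = {}"
      using g(3) h1 h2 dom_heap_image_disjoint[OF inj] by blast
    moreover have "models k U s h1 \<phi>" "models k U s h2 \<psi>"
      using g(5,6) h1 h2 Star.IH(1)[OF h1(1) Star.prems(2)] Star.IH(2)[OF h2(1) Star.prems(2)]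
      by blast+
    ultimately show "models k U s h (Star \<phi> \<psi>)"
      using h1(1) h2(1) unfolding models.simps by blast
  next
    assume "models k U s h (Star \<phi> \<psi>)"
    then obtain h1 h2 where h: "is_heap k U h1" "is_heap k U h2"
      "dom h1 \<inter> dom h2 = {}" "h = h1 ++ h2" "models k U s h1 \<phi>" "models k U s h2 \<psi>" by auto
    have "is_heap k (f ` U) (heap_image U f h1)" "is_heap k (f ` U) (heap_image U f h2)"
      using is_heap_heap_image[OF inj] h(1,2) by blast+
    moreover have "dom (heap_image U f h1) \<inter> dom (heap_image U f h2) = {}"
      using dom_heap_image_disjoint[OF inj h(1,2)] h(3) by blast
    moreover have "heap_image U f h = heap_image U f h1 ++ heap_image U f h2"
      using h(4) by (simp add: heap_image_add)
    moreover have "models k (f ` U) (f \<circ> s) (heap_image U f h1) \<phi>"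
      "models k (f ` U) (f \<circ> s) (heap_image U f h2) \<psi>"
      using Star.IH(1)[OF h(1) Star.prems(2)] Star.IH(2)[OF h(2) Star.prems(2)] h(5,6) by blast+
    ultimately show "models k (f ` U) (f \<circ> s) (heap_image U f h) (Star \<phi> \<psi>)"
      unfolding models.simps by blast
  qed
next
  case (Wand \<phi> \<psi>)
  have step: "models k (f ` U) (f \<circ> s) (heap_image U f h ++ heap_image U f h') \<psi>
      \<longleftrightarrow> models k U s (h ++ h') \<psi>" if "is_heap k U h'" for h'
    using Wand.IH(2)[OF is_heap_add[OF Wand.prems(1) that] Wand.prems(2)]
    unfolding heap_image_add .
  show ?case
  proof
    assume L: "models k (f ` U) (f \<circ> s) (heap_image U f h) (Wand \<phi> \<psi>)"
    have "models k U s (h ++ h') \<psi>"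
      if h': "is_heap k U h'" "dom h \<inter> dom h' = {}" "models k U s h' \<phi>" for h'
    proof -
      have "is_heap k (f ` U) (heap_image U f h')" using is_heap_heap_image[OF inj h'(1)] .
      moreover have "dom (heap_image U f h) \<inter> dom (heap_image U f h') = {}"
        using dom_heap_image_disjoint[OF inj Wand.prems(1) h'(1)] h'(2) by simp
      moreover have "models k (f ` U) (f \<circ> s) (heap_image U f h') \<phi>"
        using Wand.IH(1)[OF h'(1) Wand.prems(2)] h'(3) by blast
      ultimately show ?thesis using L step[OF h'(1)] unfolding models.simps by blast
    qed
    then show "models k U s h (Wand \<phi> \<psi>)" by simp
  next
    assume R: "models k U s h (Wand \<phi> \<psi>)"
    have "models k (f ` U) (f \<circ> s) (heap_image U f h ++ g) \<psi>"
      if g: "is_heap k (f ` U) g" "dom (heap_image U f h) \<inter> dom g = {}"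
        "models k (f ` U) (f \<circ> s) g \<phi>" for g
    proof -
      obtain h' where h': "is_heap k U h'" "g = heap_image U f h'"
        using heap_image_surj[OF inj g(1)] .
      have "dom h \<inter> dom h' = {}"
        using dom_heap_image_disjoint[OF inj Wand.prems(1) h'(1)] g(2) h'(2) by simp
      moreover have "models k U s h' \<phi>"
        using Wand.IH(1)[OF h'(1) Wand.prems(2)] g(3) h'(2) by blast
      ultimately show ?thesis using R h' step[OF h'(1)] unfolding models.simps by blast
    qed
    then show "models k (f ` U) (f \<circ> s) (heap_image U f h) (Wand \<phi> \<psi>)" by simp
  qed
next
  case (Exists x \<phi>)
  have upd: "(f \<circ> s)(x := f u) = f \<circ> s(x := u)" for u by auto
  have img: "(\<exists>v\<in>f ` U. P v) \<longleftrightarrow> (\<exists>u\<in>U. P (f u))" for P by blast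
  have "models k (f ` U) (f \<circ> s(x := u)) (heap_image U f h) \<phi> \<longleftrightarrow> models k U (s(x := u)) h \<phi>"
    if "u \<in> U" for u
    by (rule Exists.IH[OF Exists.prems(1)]) (use Exists.prems(2) that in simp)
  then show ?case unfolding models.simps img upd by blast
qed auto

lemma models_nat_universe:
  fixes U :: "'u set"
  assumes "is_structure k U s h" "models k U s h \<phi>"
  shows "\<exists>(V :: nat set) s' h'. is_structure k V s' h' \<and> finite V = finite U \<and> models k V s' h' \<phi>"
proof -
  from assms obtain f :: "'u \<Rightarrow> nat" where inj: "inj_on f U"
    by (auto simp: is_structure_def countable_def)
  have "is_structure k (f ` U) (f \<circ> s) (heap_image U f h)"
    using assms(1) is_heap_heap_image[OF inj] by (auto simp: is_structure_def)
  moreover have "models k (f ` U) (f \<circ> s) (heap_image U f h) \<phi>"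
    using assms models_heap_image[OF inj] by (auto simp: is_structure_def)
  moreover have "finite (f ` U) = finite U" using inj finite_image_iff by blast
  ultimately show ?thesis by blast
qed

text \<open>Partial recursive functions, with \<open>rec_eval f xs y\<close> stating that \<open>f\<close> terminates on the
  argument tuple \<open>xs\<close> with result \<open>y\<close>. Arities are not tracked by the syntax: a program applied
  to a tuple of the wrong length simply may have no result.\<close>

datatype recf =
    Zero
  | Succ
  | Proj nat
  | Comp recf "recf list"
  | PrimRec recf recf
  | Mu recf

inductive rec_eval :: "recf \<Rightarrow> nat list \<Rightarrow> nat \<Rightarrow> bool" where
  zero: "rec_eval Zero xs 0"
| succ: "rec_eval Succ [x] (Suc x)"
| proj: "i < length xs \<Longrightarrow> rec_eval (Proj i) xs (xs ! i)"
| comp: "list_all2 (\<lambda>g y. rec_eval g xs y) gs ys \<Longrightarrow> rec_eval f ys z \<Longrightarrow>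
    rec_eval (Comp f gs) xs z"
| primrec_0: "rec_eval f xs y \<Longrightarrow> rec_eval (PrimRec f g) (0 # xs) y"
| primrec_Suc: "rec_eval (PrimRec f g) (n # xs) r \<Longrightarrow> rec_eval g (n # r # xs) y \<Longrightarrow>
    rec_eval (PrimRec f g) (Suc n # xs) y"
| mu: "rec_eval f (n # xs) 0 \<Longrightarrow> (\<forall>m < n. \<exists>y. rec_eval f (m # xs) (Suc y)) \<Longrightarrow>
    rec_eval (Mu f) xs n"

inductive_cases rec_eval_elims:
  "rec_eval Zero xs y"
  "rec_eval Succ xs y"
  "rec_eval (Proj i) xs y"
  "rec_eval (Comp f gs) xs y"
  "rec_eval (PrimRec f g) (0 # xs) y"
  "rec_eval (PrimRec f g) (Suc n # xs) y"
  "rec_eval (Mu f) xs y"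

lemma rec_eval_deterministic: "rec_eval f xs y \<Longrightarrow> rec_eval f xs y' \<Longrightarrow> y = y'"
proof (induction arbitrary: y' rule: rec_eval.induct)
  case (zero xs)
  then show ?case by (rule rec_eval_elims(1)) simp
next
  case (succ x)
  then show ?case by (rule rec_eval_elims(2)) simp
next
  case (proj i xs)
  from proj(2) show ?case by (rule rec_eval_elims(3)) simp
next
  case (comp xs gs ys f z)
  from comp.prems obtain ys' where
    ys': "list_all2 (\<lambda>g y. rec_eval g xs y) gs ys'" "rec_eval f ys' y'"
    by (rule rec_eval_elims(4))
  have "ys = ys'"
  proof (rule nth_equalityI)
    have len: "length ys = length gs" "length ys' = length gs"
      using comp.IH(1) ys'(1) by (auto dest: list_all2_lengthD)
    then show "length ys = length ys'" by simp
    fix i assume "i < length ys"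
    then have "rec_eval (gs ! i) xs (ys' ! i)"
      "\<And>w. rec_eval (gs ! i) xs w \<Longrightarrow> ys ! i = w"
      using list_all2_nthD2[OF comp.IH(1)] list_all2_nthD2[OF ys'(1)] len by auto
    then show "ys ! i = ys' ! i" by blast
  qed
  then show ?case using comp.IH(2) ys'(2) by blast
next
  case (primrec_0 f xs y g)
  from primrec_0.prems have "rec_eval f xs y'" by (rule rec_eval_elims(5))
  then show ?case by (rule primrec_0.IH)
next
  case (primrec_Suc f g n xs r y)
  from primrec_Suc.prems obtain r' where
    r': "rec_eval (PrimRec f g) (n # xs) r'" "rec_eval g (n # r' # xs) y'"
    by (rule rec_eval_elims(6))
  have "r = r'" by (rule primrec_Suc.IH(1)[OF r'(1)])
  then show ?case using primrec_Suc.IH(2) r'(2) by blast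
next
  case (mu f n xs)
  from mu.prems have a: "rec_eval f (y' # xs) 0"
    and b: "\<forall>m < y'. \<exists>y. rec_eval f (m # xs) (Suc y)"
    by (auto elim: rec_eval_elims(7))
  show ?case
  proof (rule linorder_cases[of n y'])
    assume "n < y'"
    then obtain z where "rec_eval f (n # xs) (Suc z)" using b by blast
    then have "0 = Suc z" by (rule mu.IH(1))
    then show ?thesis by simp
  next
    assume "y' < n"
    then obtain z where z: "\<forall>w. rec_eval f (y' # xs) w \<longrightarrow> Suc z = w" using mu.IH(2) by blast
    have "Suc z = 0" using spec[OF z, of 0] a by (rule mp)
    then show ?thesis by simp
  qed
qed

text \<open>A decision problem is given by a set \<open>I\<close> of instances, an encoding of instances as natural
  numbers, and the property \<open>P\<close> to be decided. An algorithm may behave arbitrarily, and even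
  diverge, on numbers that do not encode an instance.\<close>

definition decidable :: "('a \<Rightarrow> nat) \<Rightarrow> 'a set \<Rightarrow> ('a \<Rightarrow> bool) \<Rightarrow> bool" where
  "decidable enc I P \<longleftrightarrow> (\<exists>f. \<forall>a\<in>I. rec_eval f [enc a] (if P a then 1 else 0))"

primrec encode_sl :: "sl \<Rightarrow> nat" where
  "encode_sl Bot = prod_encode (0, 0)"
| "encode_sl Top = prod_encode (1, 0)"
| "encode_sl Emp = prod_encode (2, 0)"
| "encode_sl (Eq x y) = prod_encode (3, prod_encode (x, y))"
| "encode_sl (PointsTo x ys) = prod_encode (4, prod_encode (x, list_encode ys))"
| "encode_sl (Conj \<phi> \<psi>) = prod_encode (5, prod_encode (encode_sl \<phi>, encode_sl \<psi>))"
| "encode_sl (Neg \<phi>) = prod_encode (6, encode_sl \<phi>)"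
| "encode_sl (Star \<phi> \<psi>) = prod_encode (7, prod_encode (encode_sl \<phi>, encode_sl \<psi>))"
| "encode_sl (Wand \<phi> \<psi>) = prod_encode (8, prod_encode (encode_sl \<phi>, encode_sl \<psi>))"
| "encode_sl (Exists x \<phi>) = prod_encode (9, prod_encode (x, encode_sl \<phi>))"

lemma encode_sl_inject: "encode_sl \<phi> = encode_sl \<psi> \<Longrightarrow> \<phi> = \<psi>"
proof (induction \<phi> arbitrary: \<psi>)
  case Bot
  then show ?case by (cases \<psi>) simp_all
next
  case Top
  then show ?case by (cases \<psi>) simp_all
next
  case Emp
  then show ?case by (cases \<psi>) simp_all
next
  case (Eq x y)
  then show ?case by (cases \<psi>) simp_all
next
  case (PointsTo x ys)
  then show ?case by (cases \<psi>) (simp_all add: list_encode_eq)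
next
  case (Conj \<phi>1 \<phi>2)
  show ?case using Conj.prems by (cases \<psi>) (auto dest: Conj.IH)
next
  case (Neg \<phi>1)
  show ?case using Neg.prems by (cases \<psi>) (auto dest: Neg.IH)
next
  case (Star \<phi>1 \<phi>2)
  show ?case using Star.prems by (cases \<psi>) (auto dest: Star.IH)
next
  case (Wand \<phi>1 \<phi>2)
  show ?case using Wand.prems by (cases \<psi>) (auto dest: Wand.IH)
next
  case (Exists x \<phi>1)
  show ?case using Exists.prems by (cases \<psi>) (auto dest: Exists.IH)
qed

lemma inj_encode_sl: "inj encode_sl"
  by (rule injI) (rule encode_sl_inject)

end

theory Submission
  imports Defs
begin

text \<open>
  A finite heap in which every pointer leads to an allocated location is a finite algebra with
  two unary functions (the first two fields), in either kind of universe, and \<open>BSR\<close> sentences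
  express universal statements about such algebras. The evaluation of a \<^typ>\<open>recf\<close> program \<open>q\<close>
  is a finite tree whose correctness is a local condition at each node, so it is described by such
  a statement; conversely, a finite algebra satisfying the local conditions yields a genuine evaluation
  by induction on \<open>q\<close>, since unbounded search needs infinitely many numbers.

  Undecidability follows by diagonalisation without a universal program. The sentence for \<open>q\<close> on
  input \<open>n\<close> has a matrix \<open>\<psi>\<close> independent of \<open>n\<close>, and the passage from \<open>encode_sl \<psi>\<close> to the
  sentence for \<open>q\<close> on input \<open>encode_sl \<psi>\<close> is recursive. Composing it with a decision procedure
  gives a program that outputs \<open>0\<close> on the code of its own matrix iff it does not.
\<close>

subsection \<open>Recursive functions\<close>

definition recursive_fun :: "nat \<Rightarrow> (nat list \<Rightarrow> nat) \<Rightarrow> bool" where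
  "recursive_fun n F \<longleftrightarrow> (\<exists>f. \<forall>xs. length xs = n \<longrightarrow> rec_eval f xs (F xs))"

lemma recursive_fun_cong:
  assumes "recursive_fun n F" "\<And>xs. length xs = n \<Longrightarrow> F xs = G xs"
  shows "recursive_fun n G"
  using assms by (auto simp: recursive_fun_def)

lemma recursive_fun_comp:
  assumes "recursive_fun (length Gs) F" "\<And>G. G \<in> set Gs \<Longrightarrow> recursive_fun n G"
  shows "recursive_fun n (\<lambda>xs. F (map (\<lambda>G. G xs) Gs))"
proof -
  obtain f where f: "\<And>xs. length xs = length Gs \<Longrightarrow> rec_eval f xs (F xs)"
    using assms(1) by (auto simp: recursive_fun_def)
  obtain g where g: "\<And>G xs. G \<in> set Gs \<Longrightarrow> length xs = n \<Longrightarrow> rec_eval (g G) xs (G xs)"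
    using assms(2) unfolding recursive_fun_def by metis
  have "rec_eval (Comp f (map g Gs)) xs (F (map (\<lambda>G. G xs) Gs))" if "length xs = n" for xs
    by (rule rec_eval.comp[where ys = "map (\<lambda>G. G xs) Gs"])
      (use that in \<open>auto simp: list_all2_conv_all_nth f g\<close>)
  then show ?thesis by (auto simp: recursive_fun_def)
qed

lemma recursive_fun_proj: "i < n \<Longrightarrow> recursive_fun n (\<lambda>xs. xs ! i)"
  unfolding recursive_fun_def by (metis rec_eval.proj)

lemma recursive_fun_Suc:
  assumes "recursive_fun n F" shows "recursive_fun n (\<lambda>xs. Suc (F xs))"
proof -
  obtain f where f: "\<And>xs. length xs = n \<Longrightarrow> rec_eval f xs (F xs)"
    using assms by (auto simp: recursive_fun_def)
  have "rec_eval (Comp Succ [f]) xs (Suc (F xs))" if "length xs = n" for xs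
    by (rule rec_eval.comp[where ys = "[F xs]"]) (use that in \<open>auto simp: f intro: rec_eval.succ\<close>)
  then show ?thesis by (auto simp: recursive_fun_def)
qed

lemma recursive_fun_const: "recursive_fun n (\<lambda>xs. c)"
proof (induction c)
  case 0
  show ?case by (auto simp: recursive_fun_def intro: rec_eval.zero)
qed (rule recursive_fun_Suc)

text \<open>\<open>PrimRec\<close> recurses on its first argument only; recursion up to a computed
  bound feeds it the value of \<open>N\<close> followed by the original arguments.\<close>

lemma recursive_fun_rec_nat:
  assumes F: "recursive_fun n F" and G: "recursive_fun (Suc (Suc n)) G" and N: "recursive_fun n N"
  shows "recursive_fun n (\<lambda>xs. rec_nat (F xs) (\<lambda>i r. G (i # r # xs)) (N xs))"
proof -
  obtain f where f: "\<And>xs. length xs = n \<Longrightarrow> rec_eval f xs (F xs)"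
    using F by (auto simp: recursive_fun_def)
  obtain g where g: "\<And>xs. length xs = Suc (Suc n) \<Longrightarrow> rec_eval g xs (G xs)"
    using G by (auto simp: recursive_fun_def)
  have "rec_eval (PrimRec f g) (m # xs) (rec_nat (F xs) (\<lambda>i r. G (i # r # xs)) m)"
    if "length xs = n" for m xs
  proof (induction m)
    case 0
    show ?case using that by (auto intro: rec_eval.primrec_0 f)
  next
    case (Suc m)
    have "rec_eval g (m # rec_nat (F xs) (\<lambda>i r. G (i # r # xs)) m # xs)
        (rec_nat (F xs) (\<lambda>i r. G (i # r # xs)) (Suc m))"
      using that by (auto intro: g)
    with Suc show ?case by (rule rec_eval.primrec_Suc)
  qed
  then have P: "recursive_fun (Suc n)
      (\<lambda>ys. rec_nat (F (tl ys)) (\<lambda>i r. G (i # r # tl ys)) (hd ys))"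
    unfolding recursive_fun_def by (intro exI[of _ "PrimRec f g"]) (auto simp: length_Suc_conv)
  let ?Gs = "N # map (\<lambda>i xs. xs ! i) [0..<n]"
  have "recursive_fun n (\<lambda>xs. (\<lambda>ys. rec_nat (F (tl ys)) (\<lambda>i r. G (i # r # tl ys)) (hd ys))
      (map (\<lambda>G. G xs) ?Gs))"
    by (rule recursive_fun_comp) (use P N in \<open>auto intro: recursive_fun_proj\<close>)
  moreover have "map (\<lambda>i. xs ! i) [0..<n] = xs" if "length xs = n" for xs :: "nat list"
    using that map_nth by blast
  ultimately show ?thesis
    by (elim recursive_fun_cong) (simp add: comp_def)
qed

lemma recursive_fun_add:
  assumes "recursive_fun n F" "recursive_fun n G"
  shows "recursive_fun n (\<lambda>xs. F xs + G xs)"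
proof -
  have "recursive_fun n (\<lambda>xs. rec_nat (F xs) (\<lambda>i r. Suc ((i # r # xs) ! 1)) (G xs))"
    by (rule recursive_fun_rec_nat[OF assms(1) _ assms(2)])
      (simp add: recursive_fun_Suc recursive_fun_proj)
  moreover have "rec_nat a (\<lambda>i r. Suc r) b = a + b" for a b :: nat
    by (induction b) auto
  ultimately show ?thesis by simp
qed

text \<open>Cantor pairing is a triangular number plus the first component, and triangular numbers
  arise by recursion from addition.\<close>

lemma recursive_fun_prod_encode:
  assumes "recursive_fun n F" "recursive_fun n G"
  shows "recursive_fun n (\<lambda>xs. prod_encode (F xs, G xs))"
proof -
  have "recursive_fun n (\<lambda>xs. rec_nat 0 (\<lambda>i r. (i # r # xs) ! 1 + Suc ((i # r # xs) ! 0))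
      (F xs + G xs))"
    by (rule recursive_fun_rec_nat)
      (use assms in \<open>simp_all add: recursive_fun_Suc recursive_fun_proj recursive_fun_const
        recursive_fun_add del: nth_Cons_0\<close>)
  moreover have "rec_nat 0 (\<lambda>i r. r + Suc i) b = triangle b" for b
    by (induction b) auto
  ultimately have "recursive_fun n (\<lambda>xs. triangle (F xs + G xs))" by simp
  from recursive_fun_add[OF this assms(1)] show ?thesis
    by (simp add: prod_encode_def)
qed

lemmas recursive_fun_intros =
  recursive_fun_const recursive_fun_Suc recursive_fun_add recursive_fun_prod_encode

subsection \<open>Formulas\<close>

abbreviation Imp :: "sl \<Rightarrow> sl \<Rightarrow> sl" where
  "Imp \<phi> \<psi> \<equiv> Neg (Conj \<phi> (Neg \<psi>))"

definition conjs :: "sl list \<Rightarrow> sl" where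
  "conjs \<phi>s = foldr Conj \<phi>s Top"

text \<open>\<open>PointsTo\<close> alone fixes the whole heap; the starred \<open>Top\<close>
  leaves the other cells free.\<close>

definition cell :: "var \<Rightarrow> var list \<Rightarrow> sl" where
  "cell x ys = Star (PointsTo x ys) Top"

text \<open>A one-cell heap at \<open>x\<close> can be added disjointly exactly when
  \<open>x\<close> is unallocated, so the implication to \<open>Bot\<close> expresses allocation.
  Repeating \<open>x\<close> as contents brings in no further variable.\<close>

definition alloc :: "nat \<Rightarrow> var \<Rightarrow> sl" where
  "alloc k x = Wand (PointsTo x (replicate k x)) Bot"

lemma models_conjs: "models k U s h (conjs \<phi>s) \<longleftrightarrow> (\<forall>\<phi>\<in>set \<phi>s. models k U s h \<phi>)"
  by (induction \<phi>s) (auto simp: conjs_def)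

lemma wf_conjs: "wf_sl k (conjs \<phi>s) \<longleftrightarrow> (\<forall>\<phi>\<in>set \<phi>s. wf_sl k \<phi>)"
  by (induction \<phi>s) (auto simp: conjs_def)

lemma quantifier_free_conjs:
  "quantifier_free (conjs \<phi>s) \<longleftrightarrow> (\<forall>\<phi>\<in>set \<phi>s. quantifier_free \<phi>)"
  by (induction \<phi>s) (auto simp: conjs_def)

lemma models_cell:
  assumes "is_heap k U h" "\<forall>x. s x \<in> U" "length ys = k"
  shows "models k U s h (cell x ys) \<longleftrightarrow> h (s x) = Some (map s ys)"
proof
  assume "models k U s h (cell x ys)"
  then show "h (s x) = Some (map s ys)"
    by (auto simp: cell_def map_add_Some_iff domIff)
next
  assume hx: "h (s x) = Some (map s ys)"
  let ?h1 = "[s x \<mapsto> map s ys]" and ?h2 = "h(s x := None)"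
  have "is_heap k U ?h1" using assms by (auto simp: is_heap_def)
  moreover have "ran ?h2 \<subseteq> ran h" by (auto simp: ran_def split: if_splits)
  then have "is_heap k U ?h2" using assms(1) by (auto simp: is_heap_def)
  moreover have "h = ?h1 ++ ?h2" using hx by (auto simp: map_add_def fun_eq_iff split: option.splits)
  ultimately show "models k U s h (cell x ys)"
    unfolding cell_def models.simps by (intro exI[of _ ?h1] exI[of _ ?h2]) auto
qed

lemma models_alloc:
  assumes "\<forall>x. s x \<in> U"
  shows "models k U s h (alloc k x) \<longleftrightarrow> s x \<in> dom h"
proof -
  have "is_heap k U [s x \<mapsto> map s (replicate k x)]"
    using assms by (auto simp: is_heap_def)
  then have "models k U s h (alloc k x) \<longleftrightarrow> dom h \<inter> dom [s x \<mapsto> map s (replicate k x)] \<noteq> {}"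
    unfolding alloc_def models.simps by blast
  then show ?thesis by auto
qed

lemma models_cong:
  "(\<And>x. x \<in> fv \<phi> \<Longrightarrow> s x = t x) \<Longrightarrow> models k U s h \<phi> \<longleftrightarrow> models k U t h \<phi>"
proof (induction \<phi> arbitrary: s t h)
  case (PointsTo x ys)
  then have "map s ys = map t ys" "s x = t x" by auto
  then show ?case by (simp only: models.simps)
next
  case (Star \<phi> \<psi>)
  have "models k U s h' \<phi> = models k U t h' \<phi>" "models k U s h' \<psi> = models k U t h' \<psi>" for h'
    by (auto intro!: Star.IH Star.prems)
  then show ?case by simp
next
  case (Wand \<phi> \<psi>)
  have "models k U s h' \<phi> = models k U t h' \<phi>" "models k U s h' \<psi> = models k U t h' \<psi>" for h'
    by (auto intro!: Wand.IH Wand.prems)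
  then show ?case by simp
next
  case (Exists x \<phi>)
  have "models k U (s(x := u)) h \<phi> = models k U (t(x := u)) h \<phi>" for u
    by (rule Exists.IH) (use Exists.prems in auto)
  then show ?case by simp
next
  case (Conj \<phi> \<psi>)
  have "models k U s h \<phi> = models k U t h \<phi>" "models k U s h \<psi> = models k U t h \<psi>"
    by (auto intro!: Conj.IH Conj.prems)
  then show ?case by simp
next
  case (Neg \<phi>)
  have "models k U s h \<phi> = models k U t h \<phi>"
    by (auto intro!: Neg.IH Neg.prems)
  then show ?case by simp
qed auto

section \<open>Variables bounded by formula codes\<close>

lemma list_encode_ge: "x \<in> set xs \<Longrightarrow> x \<le> list_encode xs"
proof (induction xs)
  case (Cons a xs)
  then show ?case
    using le_prod_encode_1[of a "list_encode xs"] le_prod_encode_2[of "list_encode xs" a]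
    by fastforce
qed simp

text \<open>Knowing only the code of a formula, one can therefore write down a quantifier prefix
  that binds all its variables.\<close>

lemma fv_le_encode_sl: "x \<in> fv \<phi> \<Longrightarrow> x \<le> encode_sl \<phi>"
proof (induction \<phi>)
  case (Eq a b)
  have "a \<le> prod_encode (a, b)" "b \<le> prod_encode (a, b)"
    by (rule le_prod_encode_1 le_prod_encode_2)+
  with Eq show ?case by (auto intro: order_trans[OF _ le_prod_encode_2])
next
  case (PointsTo a ys)
  have "a \<le> prod_encode (a, list_encode ys)" "list_encode ys \<le> prod_encode (a, list_encode ys)"
    by (rule le_prod_encode_1 le_prod_encode_2)+
  with PointsTo have "x \<le> prod_encode (a, list_encode ys)"
    using list_encode_ge by fastforce
  then show ?case by (auto intro: order_trans[OF _ le_prod_encode_2])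
next
  case (Conj \<phi> \<psi>)
  then show ?case
    by (auto intro: order_trans[OF _ le_prod_encode_2] order_trans[OF _ le_prod_encode_1])
next
  case (Star \<phi> \<psi>)
  then show ?case
    by (auto intro: order_trans[OF _ le_prod_encode_2] order_trans[OF _ le_prod_encode_1])
next
  case (Wand \<phi> \<psi>)
  then show ?case
    by (auto intro: order_trans[OF _ le_prod_encode_2] order_trans[OF _ le_prod_encode_1])
next
  case (Neg \<phi>)
  then show ?case by (auto intro: order_trans[OF _ le_prod_encode_2])
next
  case (Exists y \<phi>)
  then show ?case by (auto intro: order_trans[OF _ le_prod_encode_2])
qed auto

subsection \<open>The sentences\<close>

text \<open>The variable \<open>2 * i\<close> names the constant \<open>i\<close>: constant 0 is the root of the evaluation tree,
  1 its argument list, 2 the mark of tree nodes, and \<open>3 + i\<close> the number \<open>i\<close>. The number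
  \<open>i + 1\<close> is a cell pointing to \<open>i\<close> and zero; zero is also the empty list, so that the
  argument list \<open>[n]\<close> has the same shape.\<close>

primrec exists_even :: "nat \<Rightarrow> sl \<Rightarrow> sl" where
  "exists_even 0 \<phi> = \<phi>"
| "exists_even (Suc n) \<phi> = Exists (n + n) (exists_even n \<phi>)"

text \<open>Universal variables are odd, away from the constants. Both prefixes recurse on a number
  and use sums as indices, so that their codes are primitive recursive in the code of the
  body.\<close>

primrec forall_odd :: "nat \<Rightarrow> sl \<Rightarrow> sl" where
  "forall_odd 0 \<phi> = \<phi>"
| "forall_odd (Suc n) \<phi> = Forall (Suc (n + n)) (forall_odd n \<phi>)"

text \<open>Variable 6 is the constant zero. If \<open>y\<close> names \<open>i\<close>, then
  \<open>x\<close> names the number \<open>i + 1\<close>, or equally the list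
  \<open>[i]\<close>.\<close>

definition link :: "nat \<Rightarrow> var \<Rightarrow> var \<Rightarrow> sl" where
  "link k x y = cell x (y # replicate (k - 1) 6)"

primrec chain :: "nat \<Rightarrow> nat \<Rightarrow> sl \<Rightarrow> sl" where
  "chain k 0 \<psi> = \<psi>"
| "chain k (Suc n) \<psi> = Conj (link k (8 + (n + n)) (6 + (n + n))) (chain k n \<psi>)"

text \<open>The \<open>n + 4\<close> existential variables are the root, the argument list, the mark
  and the numbers up to \<open>n\<close>; the first link makes the argument list \<open>[n]\<close>.
  The odd variables below \<open>2 * n + 2\<close> are universal, which covers those of
  \<open>\<psi>\<close> once \<open>n\<close> bounds its code.\<close>

definition sentence :: "nat \<Rightarrow> nat \<Rightarrow> sl \<Rightarrow> sl" where
  "sentence k n \<psi> =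
     exists_even (n + 4) (forall_odd (n + 1) (Conj (link k 2 (6 + (n + n))) (chain k n \<psi>)))"

lemma exists_even_eq_foldr: "exists_even n \<phi> = foldr Exists (map (\<lambda>i. i + i) (rev [0..<n])) \<phi>"
  by (induction n) auto

lemma forall_odd_eq_foldr:
  "forall_odd n \<phi> = foldr Forall (map (\<lambda>i. Suc (i + i)) (rev [0..<n])) \<phi>"
  by (induction n) auto

lemma fv_exists_even: "fv (exists_even n \<phi>) = fv \<phi> - {x. even x \<and> x < n + n}"
proof (induction n)
  case (Suc n)
  have "{x. even x \<and> x < Suc n + Suc n} = insert (n + n) {x. even x \<and> x < n + n}"
    by (rule set_eqI, simp) presburger
  with Suc show ?case by auto
qed simp

lemma fv_forall_odd: "fv (forall_odd n \<phi>) = fv \<phi> - {x. odd x \<and> x < n + n}"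
proof (induction n)
  case (Suc n)
  have "{x. odd x \<and> x < Suc n + Suc n} = insert (Suc (n + n)) {x. odd x \<and> x < n + n}"
    by (rule set_eqI, simp) presburger
  with Suc show ?case by auto
qed simp

lemma fv_link: "fv (link k x y) \<subseteq> {x, y, 6}"
  by (auto simp: link_def cell_def)

lemma fv_chain: "fv (chain k n \<psi>) \<subseteq> fv \<psi> \<union> {x. even x \<and> x < n + n + 8}"
proof (induction n)
  case (Suc n)
  have "{8 + (n + n), 6 + (n + n), 6} \<subseteq> {x. even x \<and> x < Suc n + Suc n + 8}" by simp
  then have "fv (link k (8 + (n + n)) (6 + (n + n))) \<subseteq> {x. even x \<and> x < Suc n + Suc n + 8}"
    using fv_link by (rule order_trans[rotated])
  moreover have "{x. even x \<and> x < n + n + 8} \<subseteq> {x. even x \<and> x < Suc n + Suc n + 8}" by auto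
  ultimately show ?case using Suc unfolding chain.simps fv.simps by blast
qed simp

lemma sentence_in_BSR:
  assumes "0 < k" "wf_sl k \<psi>" "quantifier_free \<psi>" "encode_sl \<psi> \<le> n"
  shows "sentence k n \<psi> \<in> BSR k"
proof -
  let ?\<phi> = "Conj (link k 2 (6 + (n + n))) (chain k n \<psi>)"
  have "wf_sl k (chain k n \<psi>)" "quantifier_free (chain k n \<psi>)" for n
    using assms(1-3) by (induction n) (auto simp: link_def cell_def)
  then have wf: "wf_sl k ?\<phi>" "quantifier_free ?\<phi>"
    using assms(1) by (auto simp: link_def cell_def)
  have "{2, 6 + (n + n), 6} \<subseteq> {x. even x \<and> x < n + n + 8}" by simp
  then have "fv (link k 2 (6 + (n + n))) \<subseteq> {x. even x \<and> x < n + n + 8}"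
    using fv_link by (rule order_trans[rotated])
  then have "fv ?\<phi> \<subseteq> fv \<psi> \<union> {x. even x \<and> x < n + n + 8}"
    using fv_chain[of k n \<psi>] by auto
  moreover have "x < n + n + 2" if "x \<in> fv \<psi>" for x
    using fv_le_encode_sl[OF that] assms(4) by simp
  ultimately have "fv (sentence k n \<psi>) = {}"
    unfolding sentence_def fv_exists_even fv_forall_odd by fastforce
  then show ?thesis
    using wf unfolding BSR_def sentence_def exists_even_eq_foldr forall_odd_eq_foldr by blast
qed

section \<open>Computing the sentence from the code of its matrix\<close>

text \<open>The code of the matrix is never decoded: it gives the number \<open>n\<close> and seeds
  the recursions that wrap links and quantifiers around it.\<close>

lemma recursive_encode_sentence:
  assumes "0 < k"
  obtains f where "\<And>\<psi>. rec_eval f [encode_sl \<psi>] (encode_sl (sentence k (encode_sl \<psi>) \<psi>))"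
proof -
  let ?c = "list_encode (replicate (k - 1) 6)"
  let ?link = "\<lambda>x y. prod_encode (7, prod_encode
      (prod_encode (4, prod_encode (x, Suc (prod_encode (y, ?c)))), prod_encode (1, 0)))"
  have link: "encode_sl (link k x y) = ?link x y" for x y
    by (simp add: link_def cell_def)
  let ?chain = "\<lambda>n c. rec_nat c (\<lambda>i r. prod_encode (5, prod_encode (?link (8 + (i + i)) (6 + (i + i)), r))) n"
  have chain: "encode_sl (chain k n \<psi>) = ?chain n (encode_sl \<psi>)" for n \<psi>
    by (induction n) (simp_all add: link)
  let ?all = "\<lambda>n c. rec_nat c (\<lambda>i r. prod_encode (6, prod_encode (9, prod_encode (Suc (i + i), prod_encode (6, r))))) n"
  have all: "encode_sl (forall_odd n \<psi>) = ?all n (encode_sl \<psi>)" for n \<psi>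
    by (induction n) simp_all
  let ?ex = "\<lambda>n c. rec_nat c (\<lambda>i r. prod_encode (9, prod_encode (i + i, r))) n"
  have ex: "encode_sl (exists_even n \<psi>) = ?ex n (encode_sl \<psi>)" for n \<psi>
    by (induction n) simp_all
  have p: "recursive_fun 3 (\<lambda>xs. xs ! 0)" "recursive_fun 3 (\<lambda>xs. xs ! 1)" "recursive_fun 1 (\<lambda>xs. xs ! 0)"
    by (auto intro: recursive_fun_proj)
  have rec: "recursive_fun 1 (\<lambda>xs. rec_nat (F xs) (\<lambda>i r. G i r) (N xs))"
    if "recursive_fun 1 F" "recursive_fun 3 (\<lambda>xs. G (xs ! 0) (xs ! 1))" "recursive_fun 1 N" for F G N
    using recursive_fun_rec_nat[of 1 F "\<lambda>xs. G (xs ! 0) (xs ! 1)" N] that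
    by (simp add: numeral_3_eq_3)
  have "recursive_fun 1 (\<lambda>xs. ?chain (xs ! 0) (xs ! 0))"
    by (intro rec recursive_fun_intros p)
  then have "recursive_fun 1 (\<lambda>xs. ?ex (xs ! 0 + 4) (?all (xs ! 0 + 1)
      (prod_encode (5, prod_encode (?link 2 (6 + (xs ! 0 + xs ! 0)), ?chain (xs ! 0) (xs ! 0))))))"
    by (intro rec recursive_fun_intros p)
  then obtain f where f: "\<forall>xs. length xs = 1 \<longrightarrow> rec_eval f xs (?ex (xs ! 0 + 4)
      (?all (xs ! 0 + 1)
      (prod_encode (5, prod_encode (?link 2 (6 + (xs ! 0 + xs ! 0)), ?chain (xs ! 0) (xs ! 0))))))"
    unfolding recursive_fun_def by blast
  show thesis
  proof (rule that)
    fix \<psi>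
    show "rec_eval f [encode_sl \<psi>] (encode_sl (sentence k (encode_sl \<psi>) \<psi>))"
      using f[rule_format, of "[encode_sl \<psi>]"]
      by (simp only: sentence_def ex all encode_sl.simps link chain nth_Cons_0) simp
  qed
qed

section \<open>Semantics of the quantifier blocks and links\<close>

lemma models_exists_evenI:
  assumes "\<forall>x. s x \<in> U" "models k U s h \<phi>"
  shows "models k U s h (exists_even n \<phi>)"
proof (induction n)
  case (Suc n)
  then show ?case using assms(1) by (auto intro!: bexI[of _ "s (n + n)"])
qed (simp add: assms)

lemma models_exists_evenE:
  assumes "\<forall>x. s x \<in> U" "models k U s h (exists_even n \<phi>)"
  obtains t where "\<forall>x. t x \<in> U" "models k U t h \<phi>"
  using assms
proof (induction n arbitrary: s thesis)
  case (Suc n)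
  then obtain u where u: "u \<in> U" "models k U (s(n + n := u)) h (exists_even n \<phi>)" by auto
  show ?case
    by (rule Suc.IH[OF _ _ u(2)]) (use u(1) Suc.prems in auto)
qed auto

lemma models_forall_oddI:
  assumes "\<forall>x. s x \<in> U" "\<And>t. (\<forall>x. t x \<in> U) \<Longrightarrow> (\<And>x. even x \<Longrightarrow> t x = s x) \<Longrightarrow> models k U t h \<phi>"
  shows "models k U s h (forall_odd n \<phi>)"
  using assms
proof (induction n arbitrary: s)
  case (Suc n)
  have "models k U (s(Suc (n + n) := u)) h (forall_odd n \<phi>)" if "u \<in> U" for u
  proof (rule Suc.IH)
    fix t assume "\<forall>x. t x \<in> U" "\<And>x. even x \<Longrightarrow> t x = (s(Suc (n + n) := u)) x"
    moreover have "odd (Suc (n + n))" by simp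
    ultimately show "models k U t h \<phi>" by (metis Suc.prems(2) fun_upd_other)
  qed (use Suc.prems(1) that in simp)
  then show ?case by simp
qed auto

lemma models_forall_oddD:
  assumes "models k U s h (forall_odd n \<phi>)"
    and "\<forall>x. t x \<in> U" "\<And>x. even x \<or> n + n \<le> x \<Longrightarrow> t x = s x"
  shows "models k U t h \<phi>"
  using assms
proof (induction n arbitrary: s)
  case 0
  then have "t = s" by auto
  with 0 show ?case by simp
next
  case (Suc n)
  have "models k U (s(Suc (n + n) := t (Suc (n + n)))) h (forall_odd n \<phi>)"
    using Suc.prems(1,2) by simp
  then show ?case
  proof (rule Suc.IH[OF _ Suc.prems(2)])
    fix x assume "even x \<or> n + n \<le> x"
    then have "x = Suc (n + n) \<or> even x \<or> Suc n + Suc n \<le> x" by presburger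
    then show "t x = (s(Suc (n + n) := t (Suc (n + n)))) x" using Suc.prems(3) by auto
  qed
qed

lemma models_link:
  assumes "is_heap k U h" "\<forall>x. s x \<in> U" "0 < k"
  shows "models k U s h (link k x y) \<longleftrightarrow> h (s x) = Some (s y # replicate (k - 1) (s 6))"
  using assms by (simp add: link_def models_cell)

lemma models_chain:
  "models k U s h (chain k n \<psi>) \<longleftrightarrow> models k U s h \<psi> \<and>
     (\<forall>i<n. models k U s h (link k (8 + (i + i)) (6 + (i + i))))"
  by (induction n) (auto simp: less_Suc_eq)

subsection \<open>Universal path formulas\<close>

text \<open>There is one odd variable for each path from the universally quantified element. Paths of
  the \<open>sl\<close> formula range over all \<open>k\<close> fields, since \<^const>\<open>cell\<close> must name each of them; only
  the fields 0 and 1 (\<open>L\<close> and \<open>R\<close>) occur in path formulas.\<close>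

datatype step = L | R

type_synonym path = "step list"

primrec walk :: "('u \<Rightarrow> 'u) \<Rightarrow> ('u \<Rightarrow> 'u) \<Rightarrow> path \<Rightarrow> 'u \<Rightarrow> 'u" where
  "walk l r [] c = c"
| "walk l r (d # p) c = walk l r p (case d of L \<Rightarrow> l c | R \<Rightarrow> r c)"

lemma walk_append: "walk l r (p @ q) c = walk l r q (walk l r p c)"
  by (induction p arbitrary: c) auto

datatype pform = PEq path path | PConst path nat | PAnd pform pform | PNot pform

primrec holds :: "('u \<Rightarrow> 'u) \<Rightarrow> ('u \<Rightarrow> 'u) \<Rightarrow> (nat \<Rightarrow> 'u) \<Rightarrow> 'u \<Rightarrow> pform \<Rightarrow> bool" where
  "holds l r con c (PEq p q) = (walk l r p c = walk l r q c)"
| "holds l r con c (PConst p i) = (walk l r p c = con i)"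
| "holds l r con c (PAnd f g) = (holds l r con c f \<and> holds l r con c g)"
| "holds l r con c (PNot f) = (\<not> holds l r con c f)"

primrec depth :: "pform \<Rightarrow> nat" where
  "depth (PEq p q) = max (length p) (length q)"
| "depth (PConst p i) = length p"
| "depth (PAnd f g) = max (depth f) (depth g)"
| "depth (PNot f) = depth f"

primrec field :: "step \<Rightarrow> nat" where
  "field L = 0"
| "field R = 1"

definition pvar :: "nat list \<Rightarrow> var" where
  "pvar w = Suc (list_encode w + list_encode w)"

primrec sl_of :: "pform \<Rightarrow> sl" where
  "sl_of (PEq p q) = Eq (pvar (map field p)) (pvar (map field q))"
| "sl_of (PConst p i) = Eq (pvar (map field p)) (i + i)"
| "sl_of (PAnd f g) = Conj (sl_of f) (sl_of g)"
| "sl_of (PNot f) = Neg (sl_of f)"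

text \<open>Says that the word variables spell out the unfolding of the heap from
  \<open>pvar []\<close> to depth \<open>d\<close>. As a premise under universal quantifiers it lets
  variables stand for path terms.\<close>

definition expand :: "nat \<Rightarrow> nat \<Rightarrow> sl" where
  "expand k d = conjs (map (\<lambda>w. cell (pvar w) (map (\<lambda>i. pvar (w @ [i])) [0..<k]))
     (concat (map (\<lambda>m. List.n_lists m [0..<k]) [0..<d])))"

text \<open>The root is allocated, allocated cells point to allocated ones, and \<open>f\<close>
  holds at each of them; the premises restrict the universal quantifiers to cells. The
  \<open>Suc\<close> makes the element itself a cell even when \<open>f\<close> has depth 0.\<close>

definition matrix :: "nat \<Rightarrow> pform \<Rightarrow> sl" where
  "matrix k f = Conj (alloc k 0)
     (Conj (Imp (expand k 1) (conjs (map (\<lambda>i. alloc k (pvar [i])) [0..<k])))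
       (Imp (expand k (Suc (depth f))) (sl_of f)))"

lemma wf_matrix: "wf_sl k (matrix k f)"
proof -
  have "wf_sl k (sl_of f)" by (induction f) auto
  then show ?thesis by (auto simp: matrix_def expand_def wf_conjs alloc_def cell_def)
qed

lemma quantifier_free_matrix: "quantifier_free (matrix k f)"
proof -
  have "quantifier_free (sl_of f)" by (induction f) auto
  then show ?thesis by (auto simp: matrix_def expand_def quantifier_free_conjs alloc_def cell_def)
qed

lemma models_expand:
  assumes "is_heap k U h" "\<forall>x. s x \<in> U"
  shows "models k U s h (expand k d) \<longleftrightarrow>
    (\<forall>w. set w \<subseteq> {..<k} \<and> length w < d \<longrightarrow>
       h (s (pvar w)) = Some (map (\<lambda>i. s (pvar (w @ [i]))) [0..<k]))"
  using assms
  by (auto simp: expand_def models_conjs models_cell set_n_lists comp_def atLeast0LessThan)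

text \<open>The sentence read as a statement about the algebra on \<open>dom h\<close>. The universe
  does not occur, so finite and infinite satisfiability meet here.\<close>

definition realizes :: "nat \<Rightarrow> nat \<Rightarrow> pform \<Rightarrow> (nat \<Rightarrow> 'u) \<Rightarrow> 'u heap \<Rightarrow> bool" where
  "realizes k n f con h \<longleftrightarrow>
     con 0 \<in> dom h \<and>
     h (con 1) = Some (con (3 + n) # replicate (k - 1) (con 3)) \<and>
     (\<forall>i<n. h (con (4 + i)) = Some (con (3 + i) # replicate (k - 1) (con 3))) \<and>
     (\<forall>c\<in>dom h. set (the (h c)) \<subseteq> dom h \<and>
        holds (\<lambda>u. the (h u) ! 0) (\<lambda>u. the (h u) ! 1) con c f)"

lemma walk_pvar:
  assumes "\<And>w. set w \<subseteq> {..<k} \<Longrightarrow> length w < d \<Longrightarrow>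
       h (s (pvar w)) = Some (map (\<lambda>i. s (pvar (w @ [i]))) [0..<k])"
    and "2 \<le> k" "length p \<le> d"
  shows "walk (\<lambda>u. the (h u) ! 0) (\<lambda>u. the (h u) ! 1) p (s (pvar [])) = s (pvar (map field p))"
  using assms(3)
proof (induction p rule: rev_induct)
  case (snoc a p)
  have "set (map field p) \<subseteq> {..<k}"
  proof
    fix x assume "x \<in> set (map field p)"
    then obtain b where "x = field b" by auto
    then show "x \<in> {..<k}" using assms(2) by (cases b) auto
  qed
  moreover have "length p < d" using snoc.prems by simp
  ultimately have "h (s (pvar (map field p)))
      = Some (map (\<lambda>i. s (pvar (map field p @ [i]))) [0..<k])"
    by (intro assms(1)) auto
  with snoc assms(2) show ?case by (cases a) (auto simp: walk_append)
qed simp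

lemma models_sl_of:
  assumes "\<And>p. length p \<le> depth f \<Longrightarrow> s (pvar (map field p)) = walk l r p c"
  shows "models k U s h (sl_of f) \<longleftrightarrow> holds l r (\<lambda>i. s (i + i)) c f"
  using assms by (induction f) auto

lemma models_sentenceI:
  assumes st: "is_structure k U s h" and k: "2 \<le> k"
    and re: "realizes k n f (\<lambda>i. s (i + i)) h"
  shows "models k U s h (sentence k n (matrix k f))"
  unfolding sentence_def
proof (rule models_exists_evenI)
  have h: "is_heap k U h" and sU: "\<forall>x. s x \<in> U" using st by (auto simp: is_structure_def)
  then show "\<forall>x. s x \<in> U" by simp
  show "models k U s h (forall_odd (n + 1) (Conj (link k 2 (6 + (n + n))) (chain k n (matrix k f))))"
  proof (rule models_forall_oddI)
    fix t assume tU: "\<forall>x. t x \<in> U" and ts: "\<And>x. even x \<Longrightarrow> t x = s x"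
    have con: "t (i + i) = s (i + i)" for i by (rule ts) simp
    have re: "realizes k n f (\<lambda>i. t (i + i)) h" using re by (simp add: con)
    have "models k U t h (link k 2 (6 + (n + n)))"
      using re k by (simp add: realizes_def models_link[OF h tU] numeral_eq_Suc)
    moreover have "models k U t h (link k (8 + (i + i)) (6 + (i + i)))" if "i < n" for i
      using re k that by (simp add: realizes_def models_link[OF h tU] numeral_eq_Suc)
    moreover have "models k U t h (matrix k f)"
    proof -
      have "models k U t h (alloc k 0)"
        using re by (simp add: realizes_def models_alloc[OF tU])
      moreover have "models k U t h (alloc k (pvar [i]))"
        if e: "models k U t h (expand k 1)" and i: "i < k" for i
      proof -
        have *: "h (t (pvar [])) = Some (map (\<lambda>i. t (pvar [i])) [0..<k])"
          using e models_expand[OF h tU] by auto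
        then have "set (the (h (t (pvar [])))) \<subseteq> dom h"
          using re unfolding realizes_def by blast
        moreover have "t (pvar [i]) \<in> set (the (h (t (pvar []))))" using * i by simp
          ultimately have "t (pvar [i]) \<in> dom h" by blast
          then show ?thesis by (simp add: models_alloc[OF tU])
      qed
      moreover have "models k U t h (sl_of f)"
        if e: "models k U t h (expand k (Suc (depth f)))"
      proof -
        have *: "h (t (pvar w)) = Some (map (\<lambda>i. t (pvar (w @ [i]))) [0..<k])"
          if "set w \<subseteq> {..<k}" "length w < Suc (depth f)" for w
          using e that models_expand[OF h tU] by blast
        then have "t (pvar []) \<in> dom h" by fastforce
        then have "holds (\<lambda>u. the (h u) ! 0) (\<lambda>u. the (h u) ! 1) (\<lambda>i. t (i + i)) (t (pvar [])) f"
          using re unfolding realizes_def by blast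
        moreover have "t (pvar (map field p)) =
            walk (\<lambda>u. the (h u) ! 0) (\<lambda>u. the (h u) ! 1) p (t (pvar []))"
          if "length p \<le> depth f" for p
          by (rule walk_pvar[symmetric, OF _ k, of "Suc (depth f)"]) (use * that in auto)
        ultimately show ?thesis by (subst models_sl_of) auto
      qed
      ultimately show ?thesis by (auto simp: matrix_def models_conjs)
    qed
    ultimately show "models k U t h (Conj (link k 2 (6 + (n + n))) (chain k n (matrix k f)))"
      by (simp add: models_chain)
  qed (use sU in auto)
qed

text \<open>The universal block is instantiated with the fields of a cell to get closure, and with
  its whole unfolding to get \<open>f\<close>. The bound on the code keeps the odd variables of the
  matrix inside the block.\<close>

lemma models_sentenceE:
  assumes st: "is_structure k U s h" and k: "2 \<le> k" and n: "encode_sl (matrix k f) \<le> n"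
    and m: "models k U s h (sentence k n (matrix k f))"
  obtains con where "realizes k n f con h"
proof -
  have h: "is_heap k U h" and sU: "\<forall>x. s x \<in> U" using st by (auto simp: is_structure_def)
  obtain t where tU: "\<forall>x. t x \<in> U"
    and t: "models k U t h (forall_odd (n + 1) (Conj (link k 2 (6 + (n + n))) (chain k n (matrix k f))))"
    using models_exists_evenE[OF sU m[unfolded sentence_def]] by blast
  \<comment> \<open>\<open>st W\<close> gives the variable of each word \<open>w\<close> the value
    \<open>W w\<close> and keeps the constants.\<close>
  define st where "st W x = (if odd x then W (list_decode (x div 2)) else t x)" for W x
  have st_pvar: "st W (pvar w) = W w" and st_even: "st W (i + i) = t (i + i)" for W w i
    by (auto simp: st_def pvar_def)
  have stU: "\<forall>x. st W x \<in> U" if "\<forall>w. W w \<in> U" for W using that tU by (auto simp: st_def)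
  have mx: "models k U (st W) h (matrix k f)" if W: "\<forall>w. W w \<in> U" for W
  proof -
    \<comment> \<open>Odd variables beyond the block must keep their old values; the matrix mentions
      none of them.\<close>
    let ?t = "\<lambda>x. if x < n + n + 2 then st W x else t x"
    have "models k U ?t h (Conj (link k 2 (6 + (n + n))) (chain k n (matrix k f)))"
      by (rule models_forall_oddD[OF t]) (use tU stU[OF W] in \<open>auto simp: st_def\<close>)
    then have "models k U ?t h (matrix k f)" by (simp add: models_chain)
    moreover have "models k U ?t h (matrix k f) \<longleftrightarrow> models k U (st W) h (matrix k f)"
    proof (rule models_cong)
      fix x assume "x \<in> fv (matrix k f)"
      then show "?t x = st W x" using fv_le_encode_sl n by fastforce
    qed
    ultimately show ?thesis by simp
  qed
  have "models k U t h (Conj (link k 2 (6 + (n + n))) (chain k n (matrix k f)))"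
    by (rule models_forall_oddD[OF t]) (use tU in auto)
  then have l: "models k U t h (link k 2 (6 + (n + n)))"
    "\<And>i. i < n \<Longrightarrow> models k U t h (link k (8 + (i + i)) (6 + (i + i)))"
    "models k U t h (alloc k 0)"
    by (auto simp: models_chain matrix_def)
  \<comment> \<open>Truncating the index gives every number a field, so the unfolding below is total
    on all words.\<close>
  define fd where "fd i u = the (h u) ! min i (k - 1)" for i u
  have hlen: "length (the (h c)) = k" and hU: "set (the (h c)) \<subseteq> U" "c \<in> U" if "c \<in> dom h" for c
    using that h by (fastforce simp: is_heap_def ran_def)+
  have hfd: "h c = Some (map (\<lambda>i. fd i c) [0..<k])" if c: "c \<in> dom h" for c
    using that hlen[OF that] by (auto simp: fd_def intro!: nth_equalityI)
  have fdU: "fd i c \<in> U" if "c \<in> dom h" for i c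
  proof -
    have "fd i c \<in> set (the (h c))" using hlen[OF that] k by (auto simp: fd_def)
    then show ?thesis using hU[OF that] by blast
  qed
  have fdD: "fd i c \<in> dom h" if c: "c \<in> dom h" for i c
  proof -
    \<comment> \<open>One level is enough: \<open>expand k 1\<close> mentions only the element and
      its fields.\<close>
    define W where "W w = (case w of [] \<Rightarrow> c | i # _ \<Rightarrow> fd i c)" for w :: "nat list"
    have WU: "\<forall>w. W w \<in> U" using hU[OF c] fdU[OF c] by (auto simp: W_def split: list.splits)
    have "models k U (st W) h (expand k 1)"
      unfolding models_expand[OF h stU[OF WU]] st_pvar using hfd[OF c] by (auto simp: W_def)
    then have "models k U (st W) h (alloc k (pvar [j]))" if "j < k" for j
      using mx[OF WU] that by (auto simp: matrix_def models_conjs)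
    then have "fd j c \<in> dom h" if "j < k" for j
      using that by (auto simp: models_alloc[OF stU[OF WU]] st_pvar W_def)
    moreover have "fd i c = fd (min i (k - 1)) c" by (simp add: fd_def)
    ultimately show ?thesis using k by simp
  qed
  have "set (the (h c)) \<subseteq> dom h" if "c \<in> dom h" for c
    using hfd[OF that] fdD[OF that] by auto
  moreover have "holds (\<lambda>u. the (h u) ! 0) (\<lambda>u. the (h u) ! 1) (\<lambda>i. t (i + i)) c f" if c: "c \<in> dom h" for c
  proof -
    define W where "W w = fold fd w c" for w
    have WD: "W w \<in> dom h" for w
      by (induction w rule: rev_induct) (use c fdD in \<open>auto simp: W_def simp del: domIff\<close>)
    then have WU: "\<forall>w. W w \<in> U" using hU by blast
    have *: "h (W w) = Some (map (\<lambda>i. W (w @ [i])) [0..<k])" for w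
      using hfd[OF WD] by (simp add: W_def)
    then have "models k U (st W) h (expand k (Suc (depth f)))"
      unfolding models_expand[OF h stU[OF WU]] st_pvar by auto
    then have "models k U (st W) h (sl_of f)"
      using mx[OF WU] by (auto simp: matrix_def)
    moreover have "st W (pvar (map field p)) =
        walk (\<lambda>u. the (h u) ! 0) (\<lambda>u. the (h u) ! 1) p (st W (pvar []))" for p
      by (rule walk_pvar[symmetric, OF _ k, of "length p"]) (use * in \<open>auto simp: st_pvar\<close>)
    ultimately have "holds (\<lambda>u. the (h u) ! 0) (\<lambda>u. the (h u) ! 1) (\<lambda>i. st W (i + i)) (st W (pvar [])) f"
      by (subst (asm) models_sl_of) auto
    then show ?thesis by (simp add: st_even st_pvar W_def)
  qed
  ultimately have "realizes k n f (\<lambda>i. t (i + i)) h"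
    using l k by (simp add: realizes_def models_alloc[OF tU] models_link[OF h tU] numeral_eq_Suc)
  then show thesis by (rule that)
qed

subsection \<open>Evaluation trees as path formulas\<close>

text \<open>A tree node is a list-like cell made of the mark, a tag, the list of its subtrees, the argument
  list and the result. The tag identifies the evaluated program or, for \<open>loop_tag f\<close>, a stage of
  the search performed by \<open>Mu f\<close> that starts at the first argument.\<close>

instance recf :: countable
  by countable_datatype

text \<open>Doubling leaves the odd numbers for the search stages.\<close>

definition node_tag :: "recf \<Rightarrow> nat" where
  "node_tag f = to_nat f + to_nat f"

definition loop_tag :: "recf \<Rightarrow> nat" where
  "loop_tag f = Suc (to_nat f + to_nat f)"

lemma node_tag_eq_iff [simp]: "node_tag f = node_tag g \<longleftrightarrow> f = g"
  by (simp add: node_tag_def flip: mult_2)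

lemma loop_tag_eq_iff [simp]: "loop_tag f = loop_tag g \<longleftrightarrow> f = g"
  by (simp add: loop_tag_def flip: mult_2)

lemma node_tag_neq_loop_tag [simp]: "node_tag f \<noteq> loop_tag g" "loop_tag g \<noteq> node_tag f"
  by (simp_all add: node_tag_def loop_tag_def) presburger+

definition PImp :: "pform \<Rightarrow> pform \<Rightarrow> pform" where
  "PImp f g = PNot (PAnd f (PNot g))"

definition pconj :: "pform list \<Rightarrow> pform" where
  "pconj fs = foldr PAnd fs (PEq [] [])"

lemma holds_PImp [simp]:
  "holds l r con c (PImp f g) \<longleftrightarrow> (holds l r con c f \<longrightarrow> holds l r con c g)"
  by (simp add: PImp_def)

lemma holds_pconj [simp]: "holds l r con c (pconj fs) \<longleftrightarrow> (\<forall>f\<in>set fs. holds l r con c f)"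
  by (induction fs) (auto simp: pconj_def)

abbreviation "subs \<equiv> [R, R, L]"
abbreviation "args \<equiv> [R, R, R, L]"
abbreviation "res \<equiv> [R, R, R, R]"
abbreviation "is_zero p \<equiv> PConst p 3"

definition tagged :: "path \<Rightarrow> nat \<Rightarrow> pform" where
  "tagged p t = PAnd (PConst (p @ [L]) 2) (PConst (p @ [R, L]) (3 + t))"

text \<open>The stage at \<open>m\<close> evaluates \<open>f\<close> in its first subtree. On zero
  the result is \<open>m\<close>; otherwise the second subtree is the stage at \<open>m + 1\<close>
  and passes its result up. As zero is also the empty list, a nonzero condition means a successor or
  a nonempty list.\<close>

definition loop :: "recf \<Rightarrow> pform" where
  "loop f = pconj
    [PNot (is_zero args),
     tagged (subs @ [L]) (node_tag f), PEq (subs @ L # args) args,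
     PImp (is_zero (subs @ L # res)) (PEq res (args @ [L])),
     PImp (PNot (is_zero (subs @ L # res))) (pconj
      [tagged (subs @ [R, L]) (loop_tag f),
       PNot (is_zero (subs @ [R, L] @ args)),
       PNot (is_zero (subs @ [R, L] @ args @ [L])),
       PEq (subs @ [R, L] @ args @ [L, L]) (args @ [L]),
       PEq (subs @ [R, L] @ args @ [R]) (args @ [R]),
       PEq (subs @ [R, L] @ res) res])]"

text \<open>One clause per evaluation rule, with the subtrees as premises. For \<open>Comp\<close>
  the first subtree evaluates \<open>f\<close>, on a list assembled from the results of the others;
  for \<open>Mu\<close> the subtree is the search stage at 0.\<close>

fun body :: "recf \<Rightarrow> pform" where
  "body Zero = is_zero res"
| "body Succ = pconj
    [PNot (is_zero args), is_zero (args @ [R]), PNot (is_zero res), PEq (res @ [L]) (args @ [L])]"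
| "body (Proj i) = PAnd (PEq res (args @ replicate i R @ [L]))
    (pconj (map (\<lambda>j. PNot (is_zero (args @ replicate j R))) [0..<Suc i]))"
| "body (Comp f gs) = pconj
    [tagged (subs @ [L]) (node_tag f), PEq (subs @ L # res) res,
     is_zero (subs @ L # args @ replicate (length gs) R),
     pconj (map (\<lambda>j. pconj
      [tagged (subs @ R # replicate j R @ [L]) (node_tag (gs ! j)),
       PEq (subs @ R # replicate j R @ L # args) args,
       PNot (is_zero (subs @ L # args @ replicate j R)),
       PEq (subs @ L # args @ replicate j R @ [L]) (subs @ R # replicate j R @ L # res)])
      [0..<length gs])]"
| "body (PrimRec f g) = pconj
    [PNot (is_zero args),
     PImp (is_zero (args @ [L])) (pconj
      [tagged (subs @ [L]) (node_tag f),
       PEq (subs @ L # args) (args @ [R]),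
       PEq (subs @ L # res) res]),
     PImp (PNot (is_zero (args @ [L]))) (pconj
      [tagged (subs @ [L]) (node_tag (PrimRec f g)),
       PNot (is_zero (subs @ L # args)),
       PEq (subs @ L # args @ [L]) (args @ [L, L]),
       PEq (subs @ L # args @ [R]) (args @ [R]),
       tagged (subs @ [R, L]) (node_tag g),
       PNot (is_zero (subs @ [R, L] @ args)),
       PEq (subs @ [R, L] @ args @ [L]) (args @ [L, L]),
       PNot (is_zero (subs @ [R, L] @ args @ [R])),
       PEq (subs @ [R, L] @ args @ [R, L]) (subs @ L # res),
       PEq (subs @ [R, L] @ args @ [R, R]) (args @ [R]),
       PEq (subs @ [R, L] @ res) res])]"
| "body (Mu f) = pconj
    [tagged (subs @ [L]) (loop_tag f),
     PNot (is_zero (subs @ L # args)),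
     is_zero (subs @ L # args @ [L]),
     PEq (subs @ L # args @ [R]) args,
     PEq (subs @ L # res) res]"

text \<open>Only these programs can occur below a node for the given one, which keeps the formula
  finite.\<close>

primrec subprograms :: "recf \<Rightarrow> recf list" where
  "subprograms Zero = [Zero]"
| "subprograms Succ = [Succ]"
| "subprograms (Proj i) = [Proj i]"
| "subprograms (Comp f gs) = Comp f gs # subprograms f @ concat (map subprograms gs)"
| "subprograms (PrimRec f g) = PrimRec f g # subprograms f @ subprograms g"
| "subprograms (Mu f) = Mu f # subprograms f"

text \<open>The first clause keeps zero apart from the constants for positive numbers and for
  \<open>[n]\<close>, whose right field is zero. The second asks the root for an evaluation of
  \<open>q\<close> with result 0.\<close>

definition program :: "recf \<Rightarrow> pform" where
  "program q = pconj
    ([PImp (is_zero []) (PNot (is_zero [R])),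
      PImp (PConst [] 0) (pconj [tagged [] (node_tag q), PConst args 1, is_zero res])] @
     map (\<lambda>g. PImp (tagged [] (node_tag g)) (body g)) (subprograms q) @
     map (\<lambda>g. PImp (tagged [] (loop_tag g)) (loop g)) (subprograms q))"

lemma self_in_subprograms: "g \<in> set (subprograms g)"
  by (cases g) auto

section \<open>Soundness: finite algebras yield genuine evaluations\<close>

locale evaluation =
  fixes D :: "'u set" and l r :: "'u \<Rightarrow> 'u" and con :: "nat \<Rightarrow> 'u" and q :: recf
  assumes finite_D: "finite D"
    and l_D: "\<And>c. c \<in> D \<Longrightarrow> l c \<in> D"
    and r_D: "\<And>c. c \<in> D \<Longrightarrow> r c \<in> D"
    and program: "\<And>c. c \<in> D \<Longrightarrow> holds l r con c (program q)"
begin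

abbreviation "node t c \<equiv> l c = con 2 \<and> l (r c) = con (3 + t)"

lemma holds_tagged [simp]: "holds l r con c (tagged p t) \<longleftrightarrow> node t (walk l r p c)"
  by (simp add: tagged_def walk_append)

text \<open>A relation, since the algebra may be cyclic: an element represents the number of left
  steps before zero is first reached, and possibly no number at all.\<close>

primrec num :: "nat \<Rightarrow> 'u \<Rightarrow> bool" where
  "num 0 e = (e = con 3)"
| "num (Suc n) e = (e \<noteq> con 3 \<and> num n (l e))"

primrec lst :: "nat list \<Rightarrow> 'u \<Rightarrow> bool" where
  "lst [] e = (e = con 3)"
| "lst (x # xs) e = (e \<noteq> con 3 \<and> num x (l e) \<and> lst xs (r e))"

lemma num_unique: "num m e \<Longrightarrow> num n e \<Longrightarrow> m = n"
proof (induction m arbitrary: n e)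
  case 0
  then show ?case by (cases n) auto
next
  case (Suc m)
  then show ?case by (cases n) auto
qed

text \<open>Each element represents at most one number, so a finite algebra represents finitely
  many. This is what excludes endless searches.\<close>

lemma num_bounded: "\<exists>B. \<forall>m. \<forall>e\<in>D. num m e \<longrightarrow> m \<le> B"
proof -
  have "finite (\<Union>e\<in>D. {m. num m e})"
  proof (rule finite_UN_I[OF finite_D])
    fix e
    have "{m. num m e} \<subseteq> {THE m. num m e}" using num_unique by (auto intro: the_equality[symmetric])
    then show "finite {m. num m e}" by (rule finite_subset) simp
  qed
  then obtain B where "\<forall>m\<in>(\<Union>e\<in>D. {m. num m e}). m \<le> B"
    using finite_nat_set_iff_bounded_le by blast
  then show ?thesis by blast
qed

lemma lst_nth:
  "lst xs e \<Longrightarrow> i < length xs \<Longrightarrow> num (xs ! i) (l (walk l r (replicate i R) e))"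
  by (induction xs arbitrary: e i) (auto simp: nth_Cons split: nat.splits)

lemma lst_end: "lst xs e \<Longrightarrow> walk l r (replicate (length xs) R) e = con 3"
  by (induction xs arbitrary: e) auto

lemma lstI:
  "(\<And>i. i < length xs \<Longrightarrow> walk l r (replicate i R) e \<noteq> con 3
      \<and> num (xs ! i) (l (walk l r (replicate i R) e))) \<Longrightarrow>
    walk l r (replicate (length xs) R) e = con 3 \<Longrightarrow> lst xs e"
proof (induction xs arbitrary: e)
  case (Cons x xs)
  have "e \<noteq> con 3 \<and> num x (l e)" using Cons.prems(1)[of 0] by simp
  moreover have "lst xs (r e)"
    by (rule Cons.IH) (use Cons.prems(1)[of "Suc _"] Cons.prems(2) in auto)
  ultimately show ?case by simp
qed simp

lemma walk_D: "c \<in> D \<Longrightarrow> walk l r p c \<in> D"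
  by (induction p arbitrary: c) (auto simp: l_D r_D split: step.split)

lemma holds_body:
  "g \<in> set (subprograms q) \<Longrightarrow> c \<in> D \<Longrightarrow> node (node_tag g) c \<Longrightarrow> holds l r con c (body g)"
  using program[of c] by (simp add: program_def ball_Un)

lemma holds_loop:
  "g \<in> set (subprograms q) \<Longrightarrow> c \<in> D \<Longrightarrow> node (loop_tag g) c \<Longrightarrow> holds l r con c (loop g)"
  using program[of c] by (simp add: program_def ball_Un)

abbreviation "args_of c \<equiv> l (r (r (r c)))"
abbreviation "res_of c \<equiv> r (r (r (r c)))"
abbreviation "subs_of c \<equiv> l (r (r c))"

text \<open>Stages could form a cycle in the heap, but each one carries its start \<open>m\<close>
  as a number represented in \<open>D\<close>. So \<open>m\<close> stays bounded and the search
  ends; the earlier stages supply the nonzero values that \<open>rec_eval.mu\<close>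
  requires.\<close>

lemma loop_sound:
  assumes f: "f \<in> set (subprograms q)"
    and IH: "\<And>c xs. c \<in> D \<Longrightarrow> node (node_tag f) c \<Longrightarrow> lst xs (args_of c) \<Longrightarrow>
      \<exists>y. rec_eval f xs y \<and> num y (res_of c)"
    and "c \<in> D" "node (loop_tag f) c" "lst (m # xs) (args_of c)"
    and "\<And>j. j < m \<Longrightarrow> \<exists>y. rec_eval f (j # xs) (Suc y)"
  shows "\<exists>y. rec_eval (Mu f) xs y \<and> num y (res_of c)"
proof -
  obtain B where B: "\<And>m e. e \<in> D \<Longrightarrow> num m e \<Longrightarrow> m \<le> B" using num_bounded by blast
  show ?thesis
    using assms(3-)
  \<comment> \<open>With \<open>Suc B\<close> the measure drops even at
    \<open>m = B\<close>.\<close>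
  proof (induction "Suc B - m" arbitrary: m c rule: less_induct)
    case less
    let ?d = "l (subs_of c)"
    have b: "holds l r con c (loop f)" using holds_loop f less.prems by blast
    have d: "node (node_tag f) ?d" "args_of ?d = args_of c" using b by (simp_all add: loop_def)
    have dD: "?d \<in> D" using less.prems(1) by (simp add: l_D r_D)
    obtain y where y: "rec_eval f (m # xs) y" "num y (res_of ?d)"
      using IH[OF dD d(1), of "m # xs"] d(2) less.prems(3) by auto
    have mB: "m \<le> B" by (rule B[of "l (args_of c)"]) (use less.prems in \<open>auto simp: l_D r_D\<close>)
    show ?case
    proof (cases y)
      case 0
      then have "res_of c = l (args_of c)" using b y(2) by (simp add: loop_def)
      moreover have "rec_eval (Mu f) xs m" using y(1) 0 less.prems(4) by (auto intro: rec_eval.mu)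
      ultimately show ?thesis using less.prems(3) by auto
    next
      case (Suc z)
      let ?c = "l (r (subs_of c))"
      have *: "node (loop_tag f) ?c" "args_of ?c \<noteq> con 3" "l (args_of ?c) \<noteq> con 3"
        "l (l (args_of ?c)) = l (args_of c)" "r (args_of ?c) = r (args_of c)" "res_of ?c = res_of c"
        using b y(2) Suc by (simp_all add: loop_def)
      have "\<exists>y. rec_eval (Mu f) xs y \<and> num y (res_of ?c)"
      proof (rule less.hyps)
        show "Suc B - Suc m < Suc B - m" using mB by simp
        show "?c \<in> D" using less.prems(1) by (simp add: l_D r_D)
        show "lst (Suc m # xs) (args_of ?c)" using * less.prems(3) by simp
        show "\<exists>y. rec_eval f (j # xs) (Suc y)" if "j < Suc m" for j
          using less.prems(4) y(1) Suc that by (cases "j = m") auto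
      qed (rule *(1))
      with *(6) show ?thesis by simp
    qed
  qed
qed

text \<open>The induction is on the program, because the subtree pointers of the algebra need not be
  well-founded.\<close>

lemma eval_sound:
  assumes "set (subprograms g) \<subseteq> set (subprograms q)" "c \<in> D" "node (node_tag g) c" "lst xs (args_of c)"
  shows "\<exists>y. rec_eval g xs y \<and> num y (res_of c)"
  using assms
proof (induction g arbitrary: c xs)
  case Zero
  then show ?case using holds_body[of Zero c] by (auto intro!: exI[of _ 0] rec_eval.zero)
next
  case Succ
  then have "holds l r con c (body Succ)" by (intro holds_body) auto
  with Succ.prems obtain x where "xs = [x]"
    by (cases xs; cases "tl xs") auto
  with \<open>holds l r con c (body Succ)\<close> Succ.prems show ?case
    by (auto intro!: exI[of _ "Suc x"] rec_eval.succ)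
next
  case (Proj i)
  then have "holds l r con c (body (Proj i))" by (intro holds_body) auto
  then have b: "res_of c = l (walk l r (replicate i R) (args_of c))"
    "\<And>j. j \<le> i \<Longrightarrow> walk l r (replicate j R) (args_of c) \<noteq> con 3"
    by (auto simp: walk_append less_Suc_eq_le)
  \<comment> \<open>A list with at most \<open>i\<close> entries reaches zero after at most
    \<open>i\<close> right steps, against the nonzero conditions.\<close>
  have "i < length xs" using b(2)[of "length xs"] lst_end[OF Proj.prems(4)] by (cases "i < length xs") auto
  then show ?case using lst_nth[OF Proj.prems(4)] b(1) rec_eval.proj by metis
next
  case (Comp f gs)
  then have b: "holds l r con c (body (Comp f gs))" by (intro holds_body) auto
  let ?f = "l (subs_of c)" and ?g = "\<lambda>j. l (walk l r (replicate j R) (r (subs_of c)))"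
  have f: "node (node_tag f) ?f" "res_of ?f = res_of c"
    "walk l r (replicate (length gs) R) (args_of ?f) = con 3"
    using b by (simp_all add: walk_append)
  have g: "node (node_tag (gs ! j)) (?g j)" "args_of (?g j) = args_of c"
    "walk l r (replicate j R) (args_of ?f) \<noteq> con 3"
    "l (walk l r (replicate j R) (args_of ?f)) = res_of (?g j)"
    if "j < length gs" for j
    using b that by (simp_all add: walk_append)
  have "\<exists>y. rec_eval (gs ! j) xs y \<and> num y (res_of (?g j))" if j: "j < length gs" for j
  proof (rule Comp.IH(2))
    show "gs ! j \<in> set gs" using j by simp
    then show "set (subprograms (gs ! j)) \<subseteq> set (subprograms q)" using Comp.prems(1) by auto
    show "?g j \<in> D" using Comp.prems(2) by (simp add: l_D r_D walk_D)
    show "lst xs (args_of (?g j))" using g(2)[OF j] Comp.prems(4) by simp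
  qed (rule g(1)[OF j])
  then obtain y where y: "\<And>j. j < length gs \<Longrightarrow> rec_eval (gs ! j) xs (y j) \<and> num (y j) (res_of (?g j))"
    by metis
  define ys where "ys = map y [0..<length gs]"
  have "lst ys (args_of ?f)"
    by (rule lstI) (use f(3) g y in \<open>auto simp: ys_def\<close>)
  moreover have "?f \<in> D" using Comp.prems(2) by (simp add: l_D r_D)
  ultimately obtain z where z: "rec_eval f ys z" "num z (res_of ?f)"
    using Comp.IH(1)[of ?f ys] f(1) Comp.prems(1) by auto
  have "list_all2 (\<lambda>g y. rec_eval g xs y) gs ys"
    using y by (auto simp: ys_def list_all2_conv_all_nth)
  then have "rec_eval (Comp f gs) xs z" using z(1) by (rule rec_eval.comp)
  then show ?case using z(2) f(2) by auto
next
  case (PrimRec f g)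
  have "args_of c \<noteq> con 3" using holds_body[of "PrimRec f g" c] PrimRec.prems by simp
  then obtain n zs where xs: "xs = n # zs" using PrimRec.prems(4) by (cases xs) auto
  show ?case
    using PrimRec.prems unfolding xs
  \<comment> \<open>The recursive call has the same program; only its first argument gets
    smaller.\<close>
  proof (induction n arbitrary: c)
    case 0
    then have b: "holds l r con c (body (PrimRec f g))" by (intro holds_body) auto
    let ?f = "l (subs_of c)"
    have f: "node (node_tag f) ?f" "args_of ?f = r (args_of c)" "res_of ?f = res_of c"
      using b 0 by simp_all
    have "?f \<in> D" using 0 by (simp add: l_D r_D)
    then obtain y where "rec_eval f zs y" "num y (res_of ?f)"
      using PrimRec.IH(1)[of ?f zs] f 0 by auto
    then show ?case using f(3) by (auto intro: rec_eval.primrec_0)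
  next
    case (Suc n)
    then have b: "holds l r con c (body (PrimRec f g))" by (intro holds_body) auto
    let ?f = "l (subs_of c)" and ?g = "l (r (subs_of c))"
    have nz: "l (args_of c) \<noteq> con 3" using Suc.prems by simp
    have f: "node (node_tag (PrimRec f g)) ?f" "args_of ?f \<noteq> con 3"
      "l (args_of ?f) = l (l (args_of c))" "r (args_of ?f) = r (args_of c)"
      using b nz by simp_all
    have g: "node (node_tag g) ?g" "args_of ?g \<noteq> con 3" "l (args_of ?g) = l (l (args_of c))"
      "r (args_of ?g) \<noteq> con 3" "l (r (args_of ?g)) = res_of ?f" "r (r (args_of ?g)) = r (args_of c)"
      "res_of ?g = res_of c"
      using b nz by simp_all
    have D: "?f \<in> D" "?g \<in> D" using Suc.prems by (simp_all add: l_D r_D)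
    have "lst (n # zs) (args_of ?f)" using f Suc.prems(4) by simp
    from Suc.IH[OF Suc.prems(1) D(1) f(1) this] obtain y where
      y: "rec_eval (PrimRec f g) (n # zs) y" "num y (res_of ?f)" by blast
    have "lst (n # y # zs) (args_of ?g)" using g y(2) Suc.prems(4) by simp
    from PrimRec.IH(2)[OF _ D(2) g(1) this] Suc.prems(1) obtain z where
      "rec_eval g (n # y # zs) z" "num z (res_of ?g)" by auto
    then show ?case using y(1) g(7) by (auto intro: rec_eval.primrec_Suc)
  qed
next
  case (Mu f)
  then have b: "holds l r con c (body (Mu f))" by (intro holds_body) auto
  have f: "set (subprograms f) \<subseteq> set (subprograms q)" using Mu.prems by simp
  have "\<exists>y. rec_eval (Mu f) xs y \<and> num y (res_of (l (subs_of c)))"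
  proof (rule loop_sound)
    show "f \<in> set (subprograms q)" using f self_in_subprograms by blast
    show "l (subs_of c) \<in> D" using Mu.prems by (simp add: l_D r_D)
    show "lst (0 # xs) (args_of (l (subs_of c)))" using b Mu.prems(4) by simp
    show "node (loop_tag f) (l (subs_of c))" using b by simp
  qed (use Mu.IH[OF f] in auto)
  then show ?case using b by simp
qed

end

lemma realizes_program_imp_eval:
  assumes k: "2 \<le> k" and fin: "finite (dom h)" and len: "\<And>us. us \<in> ran h \<Longrightarrow> length us = k"
    and re: "realizes k n (program q) con h"
  shows "rec_eval q [n] 0"
proof -
  let ?l = "\<lambda>u. the (h u) ! 0" and ?r = "\<lambda>u. the (h u) ! Suc 0"
  have lr: "the (h c) ! i \<in> dom h" if "c \<in> dom h" "i < k" for c i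
  proof -
    have "the (h c) \<in> ran h" using that(1) by (auto simp: ran_def)
    then have "the (h c) ! i \<in> set (the (h c))" using len that(2) by auto
    then show ?thesis using re that(1) unfolding realizes_def by blast
  qed
  interpret evaluation "dom h" ?l ?r con q
    by unfold_locales (use fin lr k re in \<open>auto simp: realizes_def simp del: domIff\<close>)
  have Z: "?r (con 3) \<noteq> con 3" if "con 3 \<in> dom h"
    using program[OF that] by (simp add: program_def)
  \<comment> \<open>A cell whose right field is zero cannot be zero itself, so the number constants
    are proper successors and \<open>[n]\<close> is nonempty.\<close>
  have cell: "c \<noteq> con 3 \<and> ?l c = d \<and> ?r c = con 3"
    if "h c = Some (d # replicate (k - 1) (con 3))" for c d
    using that Z k by (cases "c = con 3") (auto simp: nth_Cons')
  have "num i (con (3 + i))" if "i \<le> n" for i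
    using that
  proof (induction i)
    case (Suc i)
    then show ?case using cell[of "con (4 + i)" "con (3 + i)"] re
      by (simp add: realizes_def numeral_eq_Suc)
  qed simp
  then have args: "lst [n] (con 1)" using cell[of "con 1"] re by (simp add: realizes_def)
  have root: "con 0 \<in> dom h" using re by (simp add: realizes_def)
  have "node (node_tag q) (con 0)" "args_of (con 0) = con 1" "res_of (con 0) = con 3"
    using program[OF root] by (simp_all add: program_def)
  then obtain y where "rec_eval q [n] y" "num y (con 3)"
    using eval_sound[OF _ root, of q "[n]"] args by auto
  then show ?thesis by (cases y) auto
qed

subsection \<open>Evaluation trees as finite heaps\<close>

text \<open>The type of trees is countably infinite and serves as the infinite universe, while a
  single evaluation uses only finitely many trees.\<close>

datatype tree = Leaf nat | Nd tree tree

instance tree :: countable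
  by countable_datatype

abbreviation "zero_leaf \<equiv> Leaf 0"
abbreviation "child_leaf \<equiv> Leaf 1"
abbreviation "mark \<equiv> Leaf 2"

text \<open>Leaves become cells too and need fields. All point to \<open>child_leaf\<close>, which
  loops; it differs from zero, as the first clause of \<open>program\<close> demands, and from the
  mark, so no leaf looks like a tree node.\<close>

primrec left :: "tree \<Rightarrow> tree" where
  "left (Leaf i) = child_leaf"
| "left (Nd a b) = a"

primrec right :: "tree \<Rightarrow> tree" where
  "right (Leaf i) = child_leaf"
| "right (Nd a b) = b"

primrec subtrees :: "tree \<Rightarrow> tree set" where
  "subtrees (Leaf i) = {Leaf i}"
| "subtrees (Nd a b) = insert (Nd a b) (subtrees a \<union> subtrees b)"

primrec tnum :: "nat \<Rightarrow> tree" where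
  "tnum 0 = zero_leaf"
| "tnum (Suc n) = Nd (tnum n) zero_leaf"

primrec tlist :: "tree list \<Rightarrow> tree" where
  "tlist [] = zero_leaf"
| "tlist (t # ts) = Nd t (tlist ts)"

definition tnode :: "nat \<Rightarrow> tree list \<Rightarrow> nat list \<Rightarrow> nat \<Rightarrow> tree" where
  "tnode t ts xs y = Nd mark (Nd (tnum t) (Nd (tlist ts) (Nd (tlist (map tnum xs)) (tnum y))))"

definition tcon :: "tree \<Rightarrow> tree \<Rightarrow> nat \<Rightarrow> tree" where
  "tcon u v i = (if i = 0 then u else if i = 1 then v else if i = 2 then mark else tnum (i - 3))"

lemma tcon_simps [simp]:
  "tcon u v 0 = u" "tcon u v 1 = v" "tcon u v (Suc 0) = v" "tcon u v 2 = mark"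
  "tcon u v 3 = zero_leaf" "tcon u v (3 + i) = tnum i"
  by (simp_all add: tcon_def)

lemma finite_subtrees: "finite (subtrees t)"
  by (induction t) auto

lemma self_in_subtrees [simp]: "t \<in> subtrees t"
  by (cases t) auto

lemma subtrees_closed: "c \<in> subtrees t \<Longrightarrow> {left c, right c} \<subseteq> insert child_leaf (subtrees t)"
  by (induction t) auto

lemma tnum_eq_iff [simp]: "tnum m = tnum n \<longleftrightarrow> m = n"
proof (induction m arbitrary: n)
  case 0
  show ?case by (cases n) auto
next
  case (Suc m)
  then show ?case by (cases n) auto
qed

lemma tnum_eq_zero [simp]: "tnum m = zero_leaf \<longleftrightarrow> m = 0" "zero_leaf = tnum m \<longleftrightarrow> m = 0"
  by (cases m; simp)+

lemma not_mark [simp]: "tnum n \<noteq> mark" "tlist ts \<noteq> mark"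
  by (cases n, simp_all) (cases ts, simp_all)

lemma tnum_subtrees: "i \<le> n \<Longrightarrow> tnum i \<in> subtrees (tnum n)"
  by (induction n) (auto simp: le_Suc_eq)

lemma walk_tlist:
  "walk left right (replicate (length ts) R) (tlist ts) = zero_leaf"
  "i < length ts \<Longrightarrow> walk left right (replicate i R) (tlist ts) \<noteq> zero_leaf"
  "i < length ts \<Longrightarrow> left (walk left right (replicate i R) (tlist ts)) = ts ! i"
proof -
  show "walk left right (replicate (length ts) R) (tlist ts) = zero_leaf"
    by (induction ts) auto
  show "i < length ts \<Longrightarrow> walk left right (replicate i R) (tlist ts) \<noteq> zero_leaf"
    by (induction ts arbitrary: i) (auto simp: less_Suc_eq_0_disj)
  show "i < length ts \<Longrightarrow> left (walk left right (replicate i R) (tlist ts)) = ts ! i"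
    by (induction ts arbitrary: i) (auto simp: less_Suc_eq_0_disj)
qed

text \<open>\<open>body\<close> and \<open>loop\<close> mention neither the root constant
  \<open>u\<close> nor the argument constant \<open>v\<close>; quantifying over both lets trees be
  built bottom up before the final root is known.\<close>

definition clauses_at :: "tree \<Rightarrow> bool" where
  "clauses_at c \<longleftrightarrow> (\<forall>u v g.
     (holds left right (tcon u v) c (tagged [] (node_tag g)) \<longrightarrow> holds left right (tcon u v) c (body g)) \<and>
     (holds left right (tcon u v) c (tagged [] (loop_tag g)) \<longrightarrow> holds left right (tcon u v) c (loop g)))"

abbreviation "admissible t \<equiv> (\<forall>c\<in>subtrees t. clauses_at c)"

lemma holds_tagged_tcon [simp]:
  "holds left right (tcon u v) c (tagged p t) \<longleftrightarrow>
     left (walk left right p c) = mark \<and> left (right (walk left right p c)) = tnum t"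
  by (simp add: tagged_def walk_append)

lemma clauses_at_unmarked: "left c \<noteq> mark \<Longrightarrow> clauses_at c"
  by (simp add: clauses_at_def)

lemma admissible_tnum: "admissible (tnum n)"
  by (induction n) (auto simp: clauses_at_unmarked)

text \<open>A list cell headed by the mark would look like a tree node, hence the condition on the
  entries.\<close>

lemma admissible_tlist:
  "(\<And>t. t \<in> set ts \<Longrightarrow> admissible t \<and> t \<noteq> mark) \<Longrightarrow> admissible (tlist ts)"
  by (induction ts) (auto simp: clauses_at_unmarked)

lemma admissible_tnode:
  assumes "\<And>t. t \<in> set ts \<Longrightarrow> admissible t \<and> t \<noteq> mark" "clauses_at (tnode t ts xs y)"
  shows "admissible (tnode t ts xs y)"
proof -
  have "admissible (tlist (map tnum xs))"
    by (rule admissible_tlist) (auto simp: admissible_tnum)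
  with assms(2) admissible_tlist[OF assms(1)] admissible_tnum show ?thesis
    by (auto simp: tnode_def clauses_at_unmarked)
qed

lemma tnode_neq_mark [simp]: "tnode t ts xs y \<noteq> mark"
  by (simp add: tnode_def)

lemma clauses_at_node:
  "(\<And>u v. holds left right (tcon u v) (tnode (node_tag g) ts xs y) (body g)) \<Longrightarrow>
    clauses_at (tnode (node_tag g) ts xs y)"
  by (simp add: clauses_at_def) (simp add: tnode_def)

lemma clauses_at_loop:
  "(\<And>u v. holds left right (tcon u v) (tnode (loop_tag g) ts xs y) (loop g)) \<Longrightarrow>
    clauses_at (tnode (loop_tag g) ts xs y)"
  by (simp add: clauses_at_def) (simp add: tnode_def)

definition has_tree :: "nat \<Rightarrow> nat list \<Rightarrow> nat \<Rightarrow> bool" where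
  "has_tree t xs y \<longleftrightarrow> (\<exists>ts. admissible (tnode t ts xs y))"

lemma has_tree_nodeI:
  assumes "\<And>t. t \<in> set ts \<Longrightarrow> admissible t \<and> t \<noteq> mark"
    and "\<And>u v. holds left right (tcon u v) (tnode (node_tag g) ts xs y) (body g)"
  shows "has_tree (node_tag g) xs y"
  unfolding has_tree_def by (intro exI[of _ ts] admissible_tnode clauses_at_node assms)

lemma has_tree_loopI:
  assumes "\<And>t. t \<in> set ts \<Longrightarrow> admissible t \<and> t \<noteq> mark"
    and "\<And>u v. holds left right (tcon u v) (tnode (loop_tag g) ts xs y) (loop g)"
  shows "has_tree (loop_tag g) xs y"
  unfolding has_tree_def by (intro exI[of _ ts] admissible_tnode clauses_at_loop assms)

text \<open>Rule induction: the trees of the premises become the subtrees of a new node.\<close>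

lemma rec_eval_imp_has_tree: "rec_eval g xs y \<Longrightarrow> has_tree (node_tag g) xs y"
proof (induction rule: rec_eval.induct)
  case (zero xs)
  show ?case by (rule has_tree_nodeI[of "[]"]) (auto simp: tnode_def)
next
  case (succ x)
  show ?case by (rule has_tree_nodeI[of "[]"]) (auto simp: tnode_def)
next
  case (proj i xs)
  show ?case
    by (rule has_tree_nodeI[of "[]"])
      (use proj walk_tlist(2,3)[of _ "map tnum xs"] in \<open>auto simp: tnode_def walk_append\<close>)
next
  case (comp xs gs ys f z)
  have len: "length gs = length ys" using comp.IH(1) by (rule list_all2_lengthD)
  obtain s where s: "admissible (tnode (node_tag f) s ys z)"
    using comp.IH(2) by (auto simp: has_tree_def)
  have "\<forall>j<length gs. \<exists>ts. admissible (tnode (node_tag (gs ! j)) ts xs (ys ! j))"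
    using comp.IH(1) by (auto simp: list_all2_conv_all_nth has_tree_def)
  then obtain S where S: "\<And>j. j < length gs \<Longrightarrow> admissible (tnode (node_tag (gs ! j)) (S j) xs (ys ! j))"
    by metis
  let ?t = "\<lambda>j. tnode (node_tag (gs ! j)) (S j) xs (ys ! j)"
  let ?ts = "map ?t [0..<length gs]"
  have w: "left (walk left right (replicate j R) (tlist ?ts)) = ?t j" if "j < length gs" for j
    using walk_tlist(3)[of j ?ts] that by simp
  show ?case
  proof (rule has_tree_nodeI[of "tnode (node_tag f) s ys z # ?ts"])
    show "admissible t \<and> t \<noteq> mark" if "t \<in> set (tnode (node_tag f) s ys z # ?ts)" for t
      using that s S by auto
    show "holds left right (tcon u v)
        (tnode (node_tag (Comp f gs)) (tnode (node_tag f) s ys z # ?ts) xs z) (body (Comp f gs))" for u v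
      using walk_tlist[where ts = "map tnum ys"] w
      by (simp add: tnode_def walk_append len)
  qed
next
  case (primrec_0 f xs y g)
  then obtain s where s: "admissible (tnode (node_tag f) s xs y)" by (auto simp: has_tree_def)
  show ?case
    by (rule has_tree_nodeI[of "[tnode (node_tag f) s xs y]"]) (use s in \<open>auto simp: tnode_def\<close>)
next
  case (primrec_Suc f g n xs r y)
  then obtain s t where s: "admissible (tnode (node_tag (PrimRec f g)) s (n # xs) r)"
    and t: "admissible (tnode (node_tag g) t (n # r # xs) y)" by (auto simp: has_tree_def)
  show ?case
    by (rule has_tree_nodeI[of "[tnode (node_tag (PrimRec f g)) s (n # xs) r, tnode (node_tag g) t (n # r # xs) y]"])
      (use s t in \<open>auto simp: tnode_def\<close>)
next
  case (mu f n xs)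
  \<comment> \<open>Stages are built downwards from the successful one at \<open>n\<close>, each
    containing the next.\<close>
  have "has_tree (loop_tag f) (m # xs) n" if "m \<le> n" for m
    using that
  proof (induction m rule: inc_induct)
    case base
    from mu.IH(1) obtain s where s: "admissible (tnode (node_tag f) s (n # xs) 0)"
      by (auto simp: has_tree_def)
    show ?case
      by (rule has_tree_loopI[of "[tnode (node_tag f) s (n # xs) 0]"])
        (use s in \<open>auto simp: tnode_def loop_def\<close>)
  next
    case (step m)
    from mu.IH(2) step(2) obtain y s where s: "admissible (tnode (node_tag f) s (m # xs) (Suc y))"
      by (auto simp: has_tree_def)
    from step(3) obtain t where t: "admissible (tnode (loop_tag f) t (Suc m # xs) n)"
      by (auto simp: has_tree_def)
    show ?case
      by (rule has_tree_loopI[of "[tnode (node_tag f) s (m # xs) (Suc y), tnode (loop_tag f) t (Suc m # xs) n]"])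
        (use s t in \<open>auto simp: tnode_def loop_def\<close>)
  qed
  then obtain s where s: "admissible (tnode (loop_tag f) s (0 # xs) n)" by (auto simp: has_tree_def)
  show ?case
    by (rule has_tree_nodeI[of "[tnode (loop_tag f) s (0 # xs) n]"]) (use s in \<open>auto simp: tnode_def\<close>)
qed

section \<open>From evaluation trees to finite heaps\<close>

primrec consts_of :: "pform \<Rightarrow> nat set" where
  "consts_of (PEq p q) = {}"
| "consts_of (PConst p i) = {i}"
| "consts_of (PAnd f g) = consts_of f \<union> consts_of g"
| "consts_of (PNot f) = consts_of f"

lemma finite_consts_of: "finite (consts_of f)"
  by (induction f) auto

text \<open>Paths never leave a closed set. This passes from the functions on trees to the heap
  fields, which agree only on the allocated trees.\<close>

lemma holds_cong:
  assumes "c \<in> T" "\<And>c. c \<in> T \<Longrightarrow> l c = l' c \<and> r c = r' c \<and> l c \<in> T \<and> r c \<in> T"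
    and "\<And>i. i \<in> consts_of f \<Longrightarrow> con i = con' i"
  shows "holds l r con c f \<longleftrightarrow> holds l' r' con' c f"
proof -
  have "walk l r p c = walk l' r' p c" for p
    using assms(1)
  proof (induction p arbitrary: c)
    case (Cons d p)
    then show ?case using assms(2)[of c] by (cases d) auto
  qed simp
  then show ?thesis using assms(3) by (induction f) auto
qed

lemma eval_imp_realizes_program:
  assumes k: "2 \<le> k" and ev: "rec_eval q [n] 0"
  obtains con and T :: "tree set" and h
  where "finite T" "range con \<subseteq> T" "is_heap k T h" "realizes k n (program q) con h"
proof -
  obtain ts where root: "admissible (tnode (node_tag q) ts [n] 0)"
    using rec_eval_imp_has_tree[OF ev] by (auto simp: has_tree_def)
  let ?root = "tnode (node_tag q) ts [n] 0" and ?args = "tlist [tnum n]"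
  obtain N where N: "\<And>i. i \<in> consts_of (program q) \<Longrightarrow> i \<le> N"
    using finite_consts_of[of "program q"] unfolding finite_nat_set_iff_bounded_le by blast
  \<comment> \<open>Constants above \<open>M\<close> are collapsed so that a finite universe can
    hold the store; \<open>M\<close> exceeds every constant of the formula and those of the numbers
    up to \<open>n\<close>.\<close>
  define M where "M = N + n + 4"
  define con where "con i = tcon ?root ?args (min i M)" for i
  define T where
    "T = {child_leaf, mark} \<union> subtrees ?root \<union> subtrees ?args \<union> subtrees (tnum M)"
  \<comment> \<open>All later fields repeat the right child, so number cells get the zeros that
    \<open>link\<close> requires.\<close>
  define h where "h t = (if t \<in> T then Some (left t # replicate (k - 1) (right t)) else None)" for t
  have dom_h: "dom h = T" by (auto simp: h_def split: if_splits)
  have fin: "finite T" by (simp add: T_def finite_subtrees)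
  have closed: "left c \<in> T \<and> right c \<in> T" if "c \<in> T" for c
    using that subtrees_closed[of c ?root] subtrees_closed[of c ?args]
      subtrees_closed[of c "tnum M"] unfolding T_def by auto
  have "tcon ?root ?args i \<in> T" if "i \<le> M" for i
    using that tnum_subtrees[of "i - 3" M] by (auto simp: T_def tcon_def)
  then have con_T: "range con \<subseteq> T" by (auto simp: con_def)
  have adm: "clauses_at c" if "c \<in> T" for c
  proof -
    have "admissible ?args" by (rule admissible_tlist) (auto simp: admissible_tnum)
    then show ?thesis
      using that root admissible_tnum[of M] by (auto simp: T_def clauses_at_unmarked)
  qed
  have heap: "is_heap k T h"
    unfolding is_heap_def dom_h
  proof (intro conjI ballI)
    fix us assume "us \<in> ran h"
    then obtain c where c: "c \<in> T" and us: "us = left c # replicate (k - 1) (right c)"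
      by (auto simp: h_def ran_def split: if_splits)
    show "length us = k" using us k by simp
    show "set us \<subseteq> T" using us closed[OF c] by auto
  qed (use fin in auto)
  have hs: "the (h c) ! 0 = left c" "the (h c) ! 1 = right c" "set (the (h c)) \<subseteq> T"
    if "c \<in> T" for c
    using that k closed[OF that] by (auto simp: h_def nth_Cons')
  have "holds left right (tcon ?root ?args) c (program q)" if "c \<in> T" for c
  proof -
    have "holds left right (tcon ?root ?args) c
        (pconj [tagged [] (node_tag q), PConst args 1, is_zero res])" if "c = ?root"
      using that by (simp add: tnode_def)
    then show ?thesis
      using adm[OF that] unfolding clauses_at_def by (auto simp: program_def)
  qed
  moreover have "holds (\<lambda>u. the (h u) ! 0) (\<lambda>u. the (h u) ! 1) con c (program q) \<longleftrightarrow>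
      holds left right (tcon ?root ?args) c (program q)" if "c \<in> T" for c
  proof (rule holds_cong[OF that])
    show "con i = tcon ?root ?args i" if "i \<in> consts_of (program q)" for i
      using N[OF that] by (simp add: con_def M_def)
  qed (use hs closed in auto)
  moreover have num: "con (3 + i) = tnum i" if "i \<le> n" for i
    using that by (simp add: con_def M_def tcon_def)
  have zero: "con 3 = zero_leaf" using num[of 0] by simp
  have "con 1 = Nd (tnum n) zero_leaf" by (simp add: con_def M_def)
  then have "h (con 1) = Some (con (3 + n) # replicate (k - 1) (con 3))"
    using rangeI[of con 1] con_T num[of n] zero unfolding h_def by auto
  moreover have "h (con (4 + i)) = Some (con (3 + i) # replicate (k - 1) (con 3))" if "i < n" for i
  proof -
    have "con (4 + i) = Nd (tnum i) zero_leaf" using num[of "Suc i"] that by (simp add: numeral_eq_Suc)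
    then show ?thesis using rangeI[of con "4 + i"] con_T num[of i] zero that unfolding h_def by auto
  qed
  moreover have "con 0 \<in> T" using con_T by auto
  ultimately have "realizes k n (program q) con h"
    using hs(3) unfolding realizes_def dom_h by auto
  then show thesis using that fin con_T heap by blast
qed

section \<open>Satisfiability as evaluation to 0\<close>

lemma realizable_program_iff:
  assumes k: "2 \<le> k" and n: "encode_sl (matrix k (program q)) \<le> n"
  shows "finitely_satisfiable k (sentence k n (matrix k (program q))) \<longleftrightarrow> rec_eval q [n] 0"
    and "infinitely_satisfiable k (sentence k n (matrix k (program q))) \<longleftrightarrow> rec_eval q [n] 0"
proof -
  let ?\<phi> = "sentence k n (matrix k (program q))"
  have sound: "rec_eval q [n] 0" if st: "is_structure k U s h" and m: "models k U s h ?\<phi>"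
    for U :: "nat set" and s h
  proof -
    obtain con where re: "realizes k n (program q) con h"
      using models_sentenceE[OF st k n m] .
    show ?thesis
      by (rule realizes_program_imp_eval[OF k _ _ re])
        (use st in \<open>auto simp: is_structure_def is_heap_def\<close>)
  qed
  have complete: "\<exists>(V :: nat set) s h. is_structure k V s h \<and> finite V = b \<and> models k V s h ?\<phi>"
    if ev: "rec_eval q [n] 0" for b
  proof -
    obtain con and T :: "tree set" and h where T: "finite T" "range con \<subseteq> T" "is_heap k T h"
      and re: "realizes k n (program q) con h"
      using eval_imp_realizes_program[OF k ev] .
    \<comment> \<open>The same heap serves both problems; only the universe around it changes.
      Halving sends the variable \<open>2 * i\<close> to the constant \<open>i\<close>.\<close>
    let ?U = "if b then T else UNIV" and ?s = "\<lambda>x. con (x div 2)"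
    have "is_structure k ?U ?s h" using T by (auto simp: is_structure_def is_heap_def)
    moreover from this have "models k ?U ?s h ?\<phi>"
      by (rule models_sentenceI[OF _ k]) (use re in \<open>simp flip: mult_2\<close>)
    moreover have "infinite (UNIV :: tree set)"
    proof -
      have "inj tnum" by (simp add: inj_def)
      then show ?thesis using infinite_UNIV_nat finite_imageD rev_finite_subset subset_UNIV by metis
    qed
    then have "finite ?U = b" using T(1) by simp
    ultimately show ?thesis using models_nat_universe by metis
  qed
  show "finitely_satisfiable k ?\<phi> \<longleftrightarrow> rec_eval q [n] 0"
    using sound complete[of True] unfolding finitely_satisfiable_def by blast
  show "infinitely_satisfiable k ?\<phi> \<longleftrightarrow> rec_eval q [n] 0"
    using sound complete[of False] unfolding infinitely_satisfiable_def by blast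
qed

section \<open>Diagonalisation\<close>

text \<open>Stated for any \<open>P\<close>, so that both problems share the argument. The input is
  the code of the matrix itself, the least value the bound on \<open>n\<close> allows.\<close>

lemma undecidable_if_diagonal:
  assumes k: "0 < k"
    and P: "\<And>q n. encode_sl (matrix k (program q)) \<le> n \<Longrightarrow>
      P (sentence k n (matrix k (program q))) \<longleftrightarrow> rec_eval q [n] 0"
  shows "\<not> decidable encode_sl (BSR k) P"
proof
  assume "decidable encode_sl (BSR k) P"
  then obtain d where d: "\<And>\<phi>. \<phi> \<in> BSR k \<Longrightarrow> rec_eval d [encode_sl \<phi>] (if P \<phi> then 1 else 0)"
    by (auto simp: decidable_def)
  obtain e where e: "\<And>\<psi>. rec_eval e [encode_sl \<psi>] (encode_sl (sentence k (encode_sl \<psi>) \<psi>))"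
    using recursive_encode_sentence[OF k] by blast
  \<comment> \<open>Given the code of a matrix, \<open>q\<close> forms the sentence with that code
    as input and returns the verdict of \<open>d\<close>; its own matrix is then a legitimate
    input.\<close>
  define q where "q = Comp d [e]"
  define \<psi> where "\<psi> = matrix k (program q)"
  let ?\<phi> = "sentence k (encode_sl \<psi>) \<psi>"
  have "?\<phi> \<in> BSR k"
    by (rule sentence_in_BSR[OF k]) (simp_all add: \<psi>_def wf_matrix quantifier_free_matrix)
  then have q: "rec_eval q [encode_sl \<psi>] (if P ?\<phi> then 1 else 0)"
    unfolding q_def by (intro rec_eval.comp[where ys = "[encode_sl ?\<phi>]"] d) (simp add: e)
  have iff: "P ?\<phi> \<longleftrightarrow> rec_eval q [encode_sl \<psi>] 0"
    unfolding \<psi>_def by (rule P) simp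
  show False
  proof (cases "P ?\<phi>")
    case True
    then show False using iff q rec_eval_deterministic by fastforce
  next
    case False
    then show False using iff q by simp
  qed
qed

theorem theorem1:
  fixes k :: nat
  assumes "k \<ge> 2"
  shows "\<not> decidable encode_sl (BSR k) (finitely_satisfiable k)
       \<and> \<not> decidable encode_sl (BSR k) (infinitely_satisfiable k)"
proof
  have k: "0 < k" using assms by simp
  show "\<not> decidable encode_sl (BSR k) (finitely_satisfiable k)"
    using undecidable_if_diagonal[OF k] realizable_program_iff(1)[OF assms] by blast
  show "\<not> decidable encode_sl (BSR k) (infinitely_satisfiable k)"
    using undecidable_if_diagonal[OF k] realizable_program_iff(2)[OF assms] by blast
qed

end
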